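(* Consider the system $$\dot x=A(t)x+g(t,x),\qquad t\in\mathbb R,\ x\in\mathbb R^n,$$ each solution of which is assumed to have the uniqueness property, and let conditions (b), (c) of the context hold, with constants $a,c,k,l$, mapping $C(\cdot)$ and function $\varphi$ as there. Suppose $$c(k+l)<\tfrac12 .$$ Then the system has a solution $x_*(t)$, $t\in\mathbb R$, such that $$\|x_*(t)\|\le r_*\varphi(t)\quad\forall t\in\mathbb R,$$ where $r_*$ is the root (in $[c/d,\infty)$) of the equation $$F(r)=F\!\left(\frac cd\right)+\frac{c^2}{2d^2}\sup_{t\in\mathbb R}\Big[\sup_{s\ge t}\lambda_C^+(s)-\inf_{s\le t}\lambda_C^-(s)\Big].$$ If, in addition, $$\|g(t,x)-g(t,y)\|\le k\|x-y\|\quad\forall (t,x,y)\in\mathbb R^{1+2n},$$ then $x_*(t)$ is the unique solution of the system for which the ratio $\|x(t)\|/\varphi(t)$ is bounded on $\mathbb R$.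
   Context: $\langle\cdot,\cdot\rangle$ is a scalar product on $\mathbb R^n$ and $\|x\|=\sqrt{\langle x,x\rangle}$. Property (a) of a mapping $S\in C^1(\mathbb R,\mathrm{Aut}(\mathbb R^n))$: for every $t\in\mathbb R$ the operator $S(t)$ is symmetric and $\mathbb R^n$ is the direct sum of two $S(t)$-invariant subspaces $\mathbb L_+(t),\mathbb L_-(t)$ such that the restriction of $S(t)$ to $\mathbb L_+(t)$ (to $\mathbb L_-(t)$) is positive-definite (negative-definite). Condition (b): $A\in C(\mathbb R,\mathrm{Hom}(\mathbb R^n))$, $\sup_{t}\|A(t)\|=:a<\infty$, and the linear system $\dot x=A(t)x$ is exponentially dichotomic on $\mathbb R$, i.e. there exists $C\in C^1(\mathbb R,\mathrm{Aut}(\mathbb R^n))$ possessing property (a) (with $S=C$) and such that $\sup_t\|C(t)\|=:c<\infty$, $\inf_t|\det C(t)|=:\sigma>0$, and $$\langle(2C(t)A(t)+\dot C(t))x,x\rangle\ge\|x\|^2\quad\forall t\in\mathbb R,\ x\in\mathbb R^n.$$ Condition (c): there exist $k>0$ and $\varphi\in C^1(\mathbb R,(0,\infty))$ such that $\sup_t\frac{|\dot\varphi(t)|}{\varphi(t)}=:l<\infty$, and $g\in C(\mathbb R^{1+n},\mathbb R^n)$ satisfies $\|g(t,x)\|\le k\|x\|+\varphi(t)$ for all $(t,x)\in\mathbb R^{1+n}$. Put $\lambda_C^+(t):=\max_{\|x\|=1}\langle C(t)x,x\rangle$, $\lambda_C^-(t):=\min_{\|x\|=1}\langle C(t)x,x\rangle$,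 $d:=\frac12-c(k+l)$, $m:=a+k+l$, and $$F(r):=\begin{cases}\frac dm r^2+2\left(\frac cm+\frac d{m^2}\right)\left(\frac1m\ln(mr+1)-r\right)&\text{if } r\ge\frac cd,\\ F\left(\frac cd\right)&\text{if }0\le r<\frac cd.\end{cases}$$ *)

theory Defs
  imports "HOL-Analysis.Analysis"
begin

text \<open>
  The space \<open>\<real>\<^sup>n\<close> with a scalar product is an arbitrary type \<open>'a\<close> of class
  \<^class>\<open>euclidean_space\<close>, so that \<open>n = DIM('a) \<ge> 1\<close> and \<open>norm x = sqrt (x \<bullet> x)\<close>. Operators are
  elements of \<open>'a \<Rightarrow>\<^sub>L 'a\<close>, whose norm is the operator norm.
\<close>

definition Aut :: "('a::euclidean_space \<Rightarrow>\<^sub>L 'a) set" where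
  "Aut = {S. bij (blinfun_apply S)}"

definition symmetric_op :: "('a::euclidean_space \<Rightarrow>\<^sub>L 'a) \<Rightarrow> bool" where
  "symmetric_op S \<longleftrightarrow> (\<forall>x y. blinfun_apply S x \<bullet> y = x \<bullet> blinfun_apply S y)"

text \<open>
  Leibniz formula in the orthonormal basis \<^const>\<open>Basis\<close>; the library's determinant is available for
  square matrices only. The two agree on \<open>real ^ 'n\<close> by \<open>op_det_eq_det_matrix\<close> below.
\<close>

definition op_det :: "('a::euclidean_space \<Rightarrow>\<^sub>L 'a) \<Rightarrow> real" where
  "op_det S = (\<Sum>p | p permutes (Basis :: 'a set).
     of_int (sign p) * (\<Prod>b\<in>Basis. blinfun_apply S (p b) \<bullet> b))"

lemma op_det_eq_det_matrix:
  fixes S :: "(real ^ 'n) \<Rightarrow>\<^sub>L (real ^ 'n)"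
  shows "op_det S = det (matrix (blinfun_apply S))"
proof -
  define e where "e = (\<lambda>i::'n. axis i (1::real))"
  have inj: "inj e"
    by (auto simp: inj_def e_def axis_eq_axis)
  have B: "(Basis :: (real ^ 'n) set) = e ` UNIV"
    by (auto simp: Basis_vec_def e_def)
  have bij: "bij_betw e UNIV Basis"
    using inj B by (simp add: bij_betw_def)
  have perm: "map_permutation UNIV e = (\<lambda>p x. if x \<in> Basis then e (p (inv_into UNIV e x)) else x)"
    using B by (auto simp: map_permutation_def restrict_id_def fun_eq_iff)
  have bij_perm: "bij_betw (map_permutation UNIV e) {p. p permutes UNIV} {p. p permutes Basis}"
    unfolding perm by (rule bij_betw_permutations[OF bij])
  have term_eq: "of_int (sign p) * (\<Prod>i\<in>UNIV. matrix (blinfun_apply S) $ i $ p i)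
    = of_int (sign (map_permutation UNIV e p)) *
        (\<Prod>b\<in>Basis. blinfun_apply S (map_permutation UNIV e p b) \<bullet> b)"
    if p: "p permutes UNIV" for p
  proof -
    have sgn: "sign (map_permutation UNIV e p) = sign p"
      using p inj by (intro sign_map_permutation) auto
    have mp: "map_permutation UNIV e p (e i) = e (p i)" for i
      using inj by (simp add: perm B)
    have "(\<Prod>b\<in>Basis. blinfun_apply S (map_permutation UNIV e p b) \<bullet> b)
        = (\<Prod>i\<in>UNIV. blinfun_apply S (map_permutation UNIV e p (e i)) \<bullet> e i)"
      by (rule prod.reindex_bij_betw[OF bij, symmetric])
    also have "\<dots> = (\<Prod>i\<in>UNIV. matrix (blinfun_apply S) $ i $ p i)"
      unfolding mp by (simp add: matrix_def e_def inner_axis)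
    finally show ?thesis
      using sgn by simp
  qed
  have "det (matrix (blinfun_apply S)) = (\<Sum>p | p permutes (UNIV :: 'n set).
      of_int (sign (map_permutation UNIV e p)) *
        (\<Prod>b\<in>Basis. blinfun_apply S (map_permutation UNIV e p b) \<bullet> b))"
    unfolding det_def by (intro sum.cong refl term_eq) auto
  also have "\<dots> = op_det S"
    unfolding op_det_def
    by (rule sum.reindex_bij_betw[OF bij_perm])
  finally show ?thesis ..
qed

definition property_a :: "(real \<Rightarrow> ('a::euclidean_space \<Rightarrow>\<^sub>L 'a)) \<Rightarrow> bool" where
  "property_a S \<longleftrightarrow> (\<forall>t. symmetric_op (S t) \<and>
     (\<exists>Lp Lm. subspace Lp \<and> subspace Lm \<and>
        Lp \<inter> Lm = {0} \<and> {x + y |x y. x \<in> Lp \<and> y \<in> Lm} = UNIV \<and>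
        blinfun_apply (S t) ` Lp \<subseteq> Lp \<and> blinfun_apply (S t) ` Lm \<subseteq> Lm \<and>
        (\<forall>x\<in>Lp. x \<noteq> 0 \<longrightarrow> blinfun_apply (S t) x \<bullet> x > 0) \<and>
        (\<forall>x\<in>Lm. x \<noteq> 0 \<longrightarrow> blinfun_apply (S t) x \<bullet> x < 0)))"

text \<open>
  \<open>C\<close> witnesses that \<open>x' = A(t) x\<close> is exponentially dichotomic on \<open>\<real>\<close>. As \<open>\<bar>det C(t)\<bar>\<close> is bounded
  below by \<open>0\<close>, its infimum is a genuine one.
\<close>

definition dichotomy_witness ::
    "(real \<Rightarrow> ('a::euclidean_space \<Rightarrow>\<^sub>L 'a)) \<Rightarrow> (real \<Rightarrow> ('a \<Rightarrow>\<^sub>L 'a)) \<Rightarrow> bool" where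
  "dichotomy_witness A C \<longleftrightarrow>
     C C1_differentiable_on UNIV \<and> range C \<subseteq> Aut \<and> property_a C \<and>
     bdd_above (range (\<lambda>t. norm (C t))) \<and>
     (INF t. \<bar>op_det (C t)\<bar>) > 0 \<and>
     (\<forall>t x. blinfun_apply (2 *\<^sub>R (C t o\<^sub>L A t) + vector_derivative C (at t)) x \<bullet> x \<ge> (norm x)\<^sup>2)"

text \<open>Maximum and minimum over the compact nonempty unit sphere, hence attained.\<close>

definition lambda_plus :: "('a::euclidean_space \<Rightarrow>\<^sub>L 'a) \<Rightarrow> real" where
  "lambda_plus S = (SUP x\<in>sphere 0 1. blinfun_apply S x \<bullet> x)"

definition lambda_minus :: "('a::euclidean_space \<Rightarrow>\<^sub>L 'a) \<Rightarrow> real" where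
  "lambda_minus S = (INF x\<in>sphere 0 1. blinfun_apply S x \<bullet> x)"

definition F_main :: "real \<Rightarrow> real \<Rightarrow> real \<Rightarrow> real \<Rightarrow> real" where
  "F_main c d m r = d / m * r\<^sup>2 + 2 * (c / m + d / m\<^sup>2) * (1 / m * ln (m * r + 1) - r)"

text \<open>Meaningful for \<open>r \<ge> 0\<close> only.\<close>

definition F_fun :: "real \<Rightarrow> real \<Rightarrow> real \<Rightarrow> real \<Rightarrow> real" where
  "F_fun c d m r = (if r \<ge> c / d then F_main c d m r else F_main c d m (c / d))"

definition is_root ::
    "(real \<Rightarrow> ('a::euclidean_space \<Rightarrow>\<^sub>L 'a)) \<Rightarrow> real \<Rightarrow> real \<Rightarrow> real \<Rightarrow> real \<Rightarrow> bool" where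
  "is_root C c d m r \<longleftrightarrow> r \<ge> c / d \<and>
     F_fun c d m r = F_fun c d m (c / d) + c\<^sup>2 / (2 * d\<^sup>2) *
       (SUP t. (SUP s\<in>{t..}. lambda_plus (C s)) - (INF s\<in>{..t}. lambda_minus (C s)))"

definition rhs ::
    "(real \<Rightarrow> ('a::euclidean_space \<Rightarrow>\<^sub>L 'a)) \<Rightarrow> (real \<Rightarrow> 'a \<Rightarrow> 'a) \<Rightarrow> real \<Rightarrow> 'a \<Rightarrow> 'a" where
  "rhs A g t x = blinfun_apply (A t) x + g t x"

definition solves_on :: "(real \<Rightarrow> 'a \<Rightarrow> 'a::euclidean_space) \<Rightarrow> real set \<Rightarrow> (real \<Rightarrow> 'a) \<Rightarrow> bool" where
  "solves_on f I x \<longleftrightarrow> (\<forall>t\<in>I. (x has_vector_derivative f t (x t)) (at t within I))"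

text \<open>Two solutions on a common interval that meet once coincide there.\<close>

definition uniqueness_property :: "(real \<Rightarrow> 'a \<Rightarrow> 'a::euclidean_space) \<Rightarrow> bool" where
  "uniqueness_property f \<longleftrightarrow>
     (\<forall>I x y t0. is_interval I \<longrightarrow> solves_on f I x \<longrightarrow> solves_on f I y \<longrightarrow>
        t0 \<in> I \<longrightarrow> x t0 = y t0 \<longrightarrow> (\<forall>t\<in>I. x t = y t))"

end

theory Submission
  imports Defs "HOL-Complex_Analysis.Great_Picard" "HOL-Real_Asymp.Real_Asymp"
begin

text \<open>
  The substitution \<open>x = \<phi>(t) y\<close> gives \<open>y' = f(t, y)\<close> with \<open>\<parallel>f(t, y)\<parallel> \<le> m \<parallel>y\<parallel> + 1\<close>, and
  \<open>w = \<langle>C(t) y, y\<rangle>\<close> satisfies \<open>w' \<ge> 2 (d \<parallel>y\<parallel>\<^sup>2 - c \<parallel>y\<parallel>)\<close> along solutions.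

  A bounded solution is a limit of Euler polygons on \<open>[-N, N]\<close> subject to \<open>y(-N) = S y(N)\<close>, where \<open>S\<close>
  is chosen such that \<open>w(-N) \<ge> w(N)\<close>. Since \<open>w\<close> increases where it is large, this condition bounds
  \<open>w\<close>, and then \<open>y\<close>, independently of \<open>N\<close>; a homotopy to the linear part of \<open>f\<close> produces the polygon.
  Working with polygons instead of solutions makes the dependence on the initial value trivially
  continuous.

  Every bounded solution obeys the estimate, because \<open>F'(r) = 2 r (d r - c) / (m r + 1)\<close> is exactly what
  makes \<open>F(\<parallel>y\<parallel>)\<close> change at most as fast as \<open>w\<close> grows while \<open>\<parallel>y\<parallel> \<ge> c/d\<close>. The difference of two bounded
  solutions satisfies \<open>w' \<ge> const \<bar>w\<bar>\<close> with \<open>w\<close> bounded on the whole line, hence vanishes.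
\<close>

subsection \<open>Topological and linear preliminaries\<close>

text \<open>Stands in for a degree argument. Without a zero, \<open>P 1\<close> maps the
  contractible whole space into the punctured one, so it is null-homotopic there on the sphere; then
  so is \<open>P 0\<close>, and undoing \<open>P 0\<close> would contract the sphere.\<close>

lemma zero_of_homotopy_to_linear:
  fixes P :: "real \<Rightarrow> 'a::euclidean_space \<Rightarrow> 'a"
  assumes cont: "continuous_on ({0..1} \<times> UNIV) (\<lambda>(l, x). P l x)"
    and lin: "linear (P 0)" and inj: "inj (P 0)" and R: "R > 0"
    and nz: "\<And>l x. l \<in> {0..1} \<Longrightarrow> norm x = R \<Longrightarrow> P l x \<noteq> 0"
  shows "\<exists>x. P 1 x = 0"
proof (rule ccontr)
  assume no: "\<nexists>x. P 1 x = 0"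
  let ?S = "sphere (0::'a) R"
  have P1: "continuous_on UNIV (P 1)"
  proof -
    have "continuous_on UNIV (\<lambda>x. case (1, x) of (l, x) \<Rightarrow> P l x)"
      by (rule continuous_on_compose2[OF cont]) (auto intro!: continuous_intros)
    then show ?thesis by simp
  qed
  have H1: "homotopic_with_canon (\<lambda>_. True) ?S (- {0}) (P 0) (P 1)"
  proof -
    have "continuous_on ({0..1} \<times> ?S) (\<lambda>(l, x). P l x)"
      by (rule continuous_on_subset[OF cont]) auto
    moreover have "(\<lambda>(l, x). P l x) \<in> {0..1} \<times> ?S \<rightarrow> - {0}"
      using nz by force
    ultimately have "continuous_map (top_of_set ({0..1} \<times> ?S)) (top_of_set (- {0})) (\<lambda>(l, x). P l x)"
      by simp
    then show ?thesis
      unfolding homotopic_with_def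
      by (intro exI[of _ "\<lambda>(l, x). P l x"]) (simp add: subtopology_Times[symmetric])
  qed
  have "continuous_on UNIV (P 1)" "P 1 \<in> UNIV \<rightarrow> - {0}" "contractible (UNIV::'a set)"
    using P1 no by (auto intro: convex_imp_contractible)
  then obtain c where "homotopic_with_canon (\<lambda>_. True) UNIV (- {0}) (P 1) (\<lambda>x. c)"
    by (rule nullhomotopic_from_contractible)
  then have "homotopic_with_canon (\<lambda>_. True) ?S (- {0}) (P 1) (\<lambda>x. c)"
    by (rule homotopic_with_subset_left) simp
  with H1 have H: "homotopic_with_canon (\<lambda>_. True) ?S (- {0}) (P 0) (\<lambda>x. c)"
    by (rule homotopic_with_trans)
  obtain Q where Q: "linear Q" "\<And>x. Q (P 0 x) = x"
    using linear_injective_left_inverse[OF lin inj] by (auto simp: fun_eq_iff)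
  have Q0: "Q y \<noteq> 0" if "y \<noteq> 0" for y
  proof -
    have "surj (P 0)" by (rule linear_inj_imp_surj[OF lin inj])
    then obtain x where "y = P 0 x" using surjD[of "P 0" y] by blast
    then show ?thesis using that Q(2)[of x] linear_0[OF lin] by auto
  qed
  \<comment> \<open>Inverse of \<open>P 0\<close> followed by radial projection, so that
    \<open>?\<psi> \<circ> P 0\<close> is the identity on the sphere.\<close>
  let ?\<psi> = "\<lambda>y. (R / norm (Q y)) *\<^sub>R Q y"
  have "continuous_on (- {0}) ?\<psi>"
    using Q0 by (intro continuous_intros linear_continuous_on Q(1)[unfolded linear_conv_bounded_linear]) auto
  moreover have "?\<psi> \<in> - {0} \<rightarrow> ?S"
  proof
    fix y :: 'a assume "y \<in> - {0}"
    then show "?\<psi> y \<in> ?S" using Q0[of y] R by simp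
  qed
  ultimately have "continuous_map (top_of_set (- {0})) (top_of_set ?S) ?\<psi>"
    by (simp only: continuous_map_in_subtopology continuous_map_subtopology_eu) auto
  from homotopic_with_compose_continuous_map_left[OF H this, of "\<lambda>_. True"]
  have "homotopic_with_canon (\<lambda>_. True) ?S ?S (?\<psi> \<circ> P 0) (\<lambda>x. ?\<psi> c)"
    by (simp add: o_def)
  then have "homotopic_with_canon (\<lambda>_. True) ?S ?S id (\<lambda>x. ?\<psi> c)"
    by (rule homotopic_with_eq) (use R Q in simp_all)
  then have "contractible ?S"
    unfolding contractible_def by blast
  then show False
    using R by (simp add: contractible_sphere)
qed

lemma bij_blinfun_right_inverse:
  fixes S :: "'a::euclidean_space \<Rightarrow>\<^sub>L 'a"
  assumes "bij (blinfun_apply S)"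
  obtains V where "\<And>x. blinfun_apply S (blinfun_apply V x) = x"
proof -
  obtain Q where Q: "linear Q" "blinfun_apply S \<circ> Q = id"
    using linear_surjective_right_inverse[OF bounded_linear.linear[OF blinfun.bounded_linear_right] bij_is_surj[OF assms]] by blast
  have "blinfun_apply (Blinfun Q) = Q"
    by (intro bounded_linear_Blinfun_apply linear_conv_bounded_linear[THEN iffD1] Q)
  with Q(2) show ?thesis
    by (intro that[of "Blinfun Q"]) (auto simp: fun_eq_iff)
qed

text \<open>For \<open>S = I + \<epsilon> C(s)\<^sup>-\<^sup>1\<close> the form of \<open>S\<^sup>* C(s) S\<close> exceeds that of \<open>C(s)\<close> by about \<open>2\<epsilon>\<close>, which
  absorbs the variation of \<open>C\<close> near \<open>s\<close>; connectedness of the line does the rest.\<close>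

lemma symmetric_path_form_le:
  fixes C :: "real \<Rightarrow> ('a::euclidean_space \<Rightarrow>\<^sub>L 'a)"
  assumes cont: "continuous_on UNIV C"
    and sym: "\<And>t. symmetric_op (C t)" and bij: "\<And>t. bij (blinfun_apply (C t))"
  shows "\<exists>S :: 'a \<Rightarrow>\<^sub>L 'a. \<forall>x. blinfun_apply (C t) x \<bullet> x \<le> blinfun_apply (C s) (blinfun_apply S x) \<bullet> blinfun_apply S x"
proof -
  define r where "r = (\<lambda>s t. \<exists>S :: 'a \<Rightarrow>\<^sub>L 'a. \<forall>x. C t x \<bullet> x \<le> C s (blinfun_apply S x) \<bullet> blinfun_apply S x)"
  have r_trans: "r s u" if st: "r s t" and tu: "r t u" for s t u
  proof -
    obtain S1 where "\<And>x. C t x \<bullet> x \<le> C s (blinfun_apply S1 x) \<bullet> blinfun_apply S1 x"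
      using st by (auto simp: r_def)
    moreover obtain S2 where "\<And>x. C u x \<bullet> x \<le> C t (blinfun_apply S2 x) \<bullet> blinfun_apply S2 x"
      using tu by (auto simp: r_def)
    ultimately have "C u x \<bullet> x \<le> C s ((S1 o\<^sub>L S2) x) \<bullet> (S1 o\<^sub>L S2) x" for x
      by (metis blinfun_apply_blinfun_compose order_trans)
    then show ?thesis unfolding r_def by blast
  qed
  have nbh: "\<exists>T. openin (top_of_set UNIV) T \<and> s \<in> T \<and> (\<forall>t\<in>T. r s t \<and> r t s)" for s
  proof -
    obtain V where V: "\<And>x. C s (blinfun_apply V x) = x"
      using bij_blinfun_right_inverse[OF bij] by blast
    \<comment> \<open>By symmetry \<open>C s x \<bullet> V x = x \<bullet> x\<close>, so the form
      gains \<open>2 * \<epsilon> * (norm x)\<^sup>2\<close>; as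
      \<open>\<epsilon> * norm V \<le> 1\<close>, the remaining term
      \<open>\<epsilon> * \<epsilon> * (x \<bullet> V x)\<close> costs at most half of it.\<close>
    define \<epsilon> where "\<epsilon> = 1 / (norm V + 1)"
    have \<epsilon>: "\<epsilon> > 0" "\<epsilon> * norm V \<le> 1"
      by (auto simp: \<epsilon>_def field_simps add_pos_nonneg)
    define S where "S = id_blinfun + \<epsilon> *\<^sub>R V"
    have S: "C s x \<bullet> x + \<epsilon> * (norm x)\<^sup>2 \<le> C s (S x) \<bullet> S x" for x
    proof -
      have a: "C s (S x) = C s x + \<epsilon> *\<^sub>R x"
        by (simp add: S_def V blinfun.bilinear_simps)
      have b: "C s x \<bullet> V x = x \<bullet> x"
        using sym[of s] V unfolding symmetric_op_def by metis
      have "\<bar>x \<bullet> V x\<bar> \<le> norm V * (norm x)\<^sup>2"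
        using Cauchy_Schwarz_ineq2[of x "V x"] norm_blinfun[of V x]
        by (smt (verit, best) mult.assoc mult.commute mult_left_mono norm_ge_zero power2_eq_square)
      then have "\<epsilon> * \<epsilon> * \<bar>x \<bullet> V x\<bar> \<le> \<epsilon> * \<epsilon> * (norm V * (norm x)\<^sup>2)"
        using \<epsilon>(1) by (intro mult_left_mono) auto
      also have "\<dots> = (\<epsilon> * norm V) * (\<epsilon> * (norm x)\<^sup>2)" by (simp add: algebra_simps)
      also have "\<dots> \<le> 1 * (\<epsilon> * (norm x)\<^sup>2)"
        using \<epsilon> by (intro mult_right_mono) auto
      finally have e: "- (\<epsilon> * (norm x)\<^sup>2) \<le> \<epsilon> * \<epsilon> * (x \<bullet> V x)"
        using \<epsilon>(1) by (smt (verit, best) mult_minus_right abs_le_D2 mult_left_mono zero_le_mult_iff)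
      have "C s (S x) \<bullet> S x = C s x \<bullet> x + \<epsilon> * (x \<bullet> x) + \<epsilon> * (C s x \<bullet> V x) + \<epsilon> * \<epsilon> * (x \<bullet> V x)"
        unfolding a by (simp add: S_def blinfun.bilinear_simps inner_add_left inner_add_right algebra_simps)
      then show ?thesis
        using e by (simp add: b power2_norm_eq_inner)
    qed
    \<comment> \<open>\<open>N\<close> dominates both \<open>1\<close> and \<open>norm S\<close>, so
      the single tolerance \<open>\<epsilon> / N\<^sup>2\<close> serves at \<open>x\<close> and at
      \<open>S x\<close>, that is, for both directions of \<open>r\<close>.\<close>
    define N where "N = norm S + 1"
    have N: "N > 0" "N\<^sup>2 \<ge> 1" "norm (S x) \<le> N * norm x" for x
    proof -
      show "N > 0" "N\<^sup>2 \<ge> 1" by (auto simp: N_def add_nonneg_pos one_le_power)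
      show "norm (S x) \<le> N * norm x"
        using norm_blinfun[of S x] by (simp add: N_def distrib_right add_increasing2)
    qed
    obtain \<delta> where \<delta>: "\<delta> > 0" "\<And>t. dist t s < \<delta> \<Longrightarrow> dist (C t) (C s) < \<epsilon> / N\<^sup>2"
      using cont \<epsilon>(1) N(1) unfolding continuous_on_iff
      by (metis UNIV_I divide_pos_pos zero_less_power)
    have "r s t \<and> r t s" if t: "t \<in> ball s \<delta>" for t
    proof -
      have n: "norm (C t - C s) \<le> \<epsilon> / N\<^sup>2"
        using \<delta>(2)[of t] t by (simp add: dist_norm dist_commute less_imp_le)
      have dif: "\<bar>C t y \<bullet> y - C s y \<bullet> y\<bar> \<le> \<epsilon> / N\<^sup>2 * (norm y)\<^sup>2" for y
      proof -
        have "C t y \<bullet> y - C s y \<bullet> y = (C t - C s) y \<bullet> y"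
          by (simp add: blinfun.bilinear_simps inner_diff_left)
        also have "\<bar>\<dots>\<bar> \<le> norm ((C t - C s) y) * norm y" by (rule Cauchy_Schwarz_ineq2)
        also have "\<dots> \<le> norm (C t - C s) * norm y * norm y"
          by (intro mult_right_mono norm_blinfun) auto
        also have "\<dots> \<le> \<epsilon> / N\<^sup>2 * norm y * norm y"
          by (intro mult_right_mono n) auto
        finally show ?thesis by (simp add: power2_eq_square mult.assoc)
      qed
      have "\<epsilon> / N\<^sup>2 * (norm x)\<^sup>2 \<le> \<epsilon> * (norm x)\<^sup>2" for x :: 'a
        using divide_left_mono[OF N(2), of \<epsilon>] \<epsilon>(1) N(1) by (intro mult_right_mono) auto
      then have "C t x \<bullet> x \<le> C s (S x) \<bullet> S x" for x
        using S[of x] dif[of x] by (smt (verit, best))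
      moreover have "\<epsilon> / N\<^sup>2 * (norm (S x))\<^sup>2 \<le> \<epsilon> * (norm x)\<^sup>2" for x
      proof -
        have "(norm (S x))\<^sup>2 \<le> (N * norm x)\<^sup>2"
          by (intro power_mono N(3)) auto
        then have "\<epsilon> / N\<^sup>2 * (norm (S x))\<^sup>2 \<le> \<epsilon> / N\<^sup>2 * (N * norm x)\<^sup>2"
          using \<epsilon>(1) by (intro mult_left_mono) auto
        then show ?thesis using N(1) by (simp add: power_mult_distrib)
      qed
      then have "C s x \<bullet> x \<le> C t (S x) \<bullet> S x" for x
        using S[of x] dif[of "S x"] by (smt (verit, best))
      ultimately show ?thesis unfolding r_def by blast
    qed
    then show ?thesis
      using \<delta>(1) by (intro exI[of _ "ball s \<delta>"]) auto
  qed
  \<comment> \<open>The symmetrised relation is transitive and holds near every point, hence relates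
    any two points of the connected line.\<close>
  have "r s t \<and> r t s"
    by (rule connected_equivalence_relation[of UNIV s t "\<lambda>s t. r s t \<and> r t s"])
      (use r_trans nbh in \<open>blast+\<close>)
  then show ?thesis
    unfolding r_def by blast
qed

subsection \<open>Limits of Euler polygons\<close>

text \<open>Compactness as in Peano's theorem: the bound on \<open>f\<close> makes the polygons
  uniformly Lipschitz up to the mesh, and a subsequence converging at the rationals converges
  everywhere. The bound starts at index \<open>q N\<close>, so nothing is asked on the first unit of
  time, from \<open>-N\<close> to \<open>1 - N\<close>.\<close>

lemma euler_polygons_limit:
  fixes f :: "real \<Rightarrow> 'a::euclidean_space \<Rightarrow> 'a" and q :: "nat \<Rightarrow> nat" and z :: "nat \<Rightarrow> nat \<Rightarrow> 'a"
  assumes cont: "continuous_on UNIV (\<lambda>(t, x). f t x)"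
    and q: "\<And>N. q N > N"
    and step: "\<And>N i. z N (Suc i) = z N i + (1 / real (q N)) *\<^sub>R f (real i / real (q N) - real N) (z N i)"
    and bd: "\<And>N i. q N \<le> i \<Longrightarrow> i \<le> 2 * N * q N \<Longrightarrow> norm (z N i) \<le> R"
    and fL: "\<And>t y. norm y \<le> R \<Longrightarrow> norm (f t y) \<le> L"
  shows "\<exists>x. (\<forall>t. norm (x t) \<le> R) \<and> solves_on f UNIV x"
proof -
  have q0: "q N > 0" for N using q[of N] by simp
  have R0: "R \<ge> 0" by (rule order_trans[OF norm_ge_zero bd[of 1 "q 1"]]) auto
  have L0: "L \<ge> 0" by (rule order_trans[OF norm_ge_zero fL[of 0 0]]) (use R0 in auto)
  \<comment> \<open>For \<open>t\<close> in the window, \<open>ix N t\<close> is the last grid node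
    at or before \<open>t\<close>; \<open>\<tau> N i\<close> is the time of node
    \<open>i\<close>.\<close>
  define ix where "ix = (\<lambda>N t. nat \<lfloor>real (q N) * (t + real N)\<rfloor>)"
  define \<tau> where "\<tau> = (\<lambda>N i. real i / real (q N) - real N)"
  have ix: "q N \<le> ix N t" "ix N t \<le> 2 * N * q N" "t - 1 / q N < \<tau> N (ix N t)" "\<tau> N (ix N t) \<le> t"
    if t: "1 - real N \<le> t" "t \<le> N" for N t
  proof -
    let ?y = "real (q N) * (t + real N)"
    have y1: "real (q N) * 1 \<le> ?y" "?y \<le> real (q N) * (2 * real N)"
      by (rule mult_left_mono; use t in simp)+
    have "?y \<ge> 0" using y1(1) by linarith
    then have e: "real (ix N t) = of_int \<lfloor>?y\<rfloor>" by (simp add: ix_def)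
    show "q N \<le> ix N t" using y1(1) unfolding ix_def by (simp add: le_nat_iff le_floor_iff)
    have "real (ix N t) \<le> ?y" unfolding e by simp
    also have "\<dots> \<le> real (2 * N * q N)" using y1(2) by (simp add: mult_ac)
    finally show "ix N t \<le> 2 * N * q N" by (simp only: of_nat_le_iff)
    have "?y < real (ix N t) + 1" "real (ix N t) \<le> ?y" unfolding e by linarith+
    then have "t + real N < (real (ix N t) + 1) / q N" "real (ix N t) / q N \<le> t + real N"
      using q0[of N] by (simp_all add: pos_less_divide_eq pos_divide_le_eq mult.commute)
    then show "t - 1 / q N < \<tau> N (ix N t)" "\<tau> N (ix N t) \<le> t"
      unfolding \<tau>_def add_divide_distrib by linarith+
  qed
  have ix_mono: "ix N s \<le> ix N t" if "s \<le> t" for N s t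
    unfolding ix_def using that by (intro nat_mono floor_mono mult_left_mono) auto
  \<comment> \<open>Used twice: \<open>v = 0\<close> yields the Lipschitz bound,
    \<open>v = f t0 (x t0)\<close> the derivative of the limit.\<close>
  have tele: "norm (z N j - z N i - (\<tau> N j - \<tau> N i) *\<^sub>R v) \<le> e * (\<tau> N j - \<tau> N i)"
    if "i \<le> j" "\<And>p. i \<le> p \<Longrightarrow> p < j \<Longrightarrow> norm (f (\<tau> N p) (z N p) - v) \<le> e" for N i j v e
    using that
  proof (induction j rule: dec_induct)
    case base
    then show ?case by simp
  next
    case (step j)
    have h: "\<tau> N (Suc j) = \<tau> N j + 1 / q N" by (simp add: \<tau>_def add_divide_distrib)
    have eq: "z N (Suc j) - z N i - (\<tau> N (Suc j) - \<tau> N i) *\<^sub>R v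
       = (z N j - z N i - (\<tau> N j - \<tau> N i) *\<^sub>R v) + (1 / q N) *\<^sub>R (f (\<tau> N j) (z N j) - v)"
      unfolding h assms(3) \<tau>_def[symmetric] by (simp add: algebra_simps \<tau>_def)
    have "norm (z N (Suc j) - z N i - (\<tau> N (Suc j) - \<tau> N i) *\<^sub>R v)
      \<le> norm (z N j - z N i - (\<tau> N j - \<tau> N i) *\<^sub>R v) + norm ((1 / q N) *\<^sub>R (f (\<tau> N j) (z N j) - v))"
      unfolding eq by (rule norm_triangle_ineq)
    also have "\<dots> \<le> e * (\<tau> N j - \<tau> N i) + (1 / q N) * e"
      using step.IH step.prems[of j] step.hyps step.prems
      by (intro add_mono) (auto simp: divide_right_mono)
    finally show ?case unfolding h by (simp add: algebra_simps)
  qed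
  have zlip: "norm (z N j - z N i) \<le> L * \<bar>\<tau> N j - \<tau> N i\<bar>"
    if "q N \<le> i" "i \<le> 2 * N * q N" "q N \<le> j" "j \<le> 2 * N * q N" for N i j
  proof -
    have *: "norm (z N j - z N i) \<le> L * \<bar>\<tau> N j - \<tau> N i\<bar>"
      if "q N \<le> i" "j \<le> 2 * N * q N" "i \<le> j" for i j
    proof -
      have "\<tau> N j \<ge> \<tau> N i" using that by (auto simp: \<tau>_def divide_right_mono)
      moreover have "norm (z N j - z N i - (\<tau> N j - \<tau> N i) *\<^sub>R 0) \<le> L * (\<tau> N j - \<tau> N i)"
        using that by (intro tele) (auto intro!: fL bd)
      ultimately show ?thesis by simp
    qed
    show ?thesis
      using *[of i j] *[of j i] that by (cases "i \<le> j") (auto simp: norm_minus_commute abs_minus_commute)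
  qed
  \<comment> \<open>The polygons as step functions; the default \<open>0\<close> outside the window
    preserves the bound \<open>R\<close>.\<close>
  define X where "X = (\<lambda>N t. if 1 - real N \<le> t \<and> t \<le> N then z N (ix N t) else 0)"
  have XR: "norm (X N t) \<le> R" for N t
    using bd ix R0 by (auto simp: X_def)
  \<comment> \<open>The extra \<open>1 / real N\<close> pays for rounding times down to the grid of
    mesh \<open>1 / q N\<close>; it vanishes in the limit.\<close>
  have Xlip: "norm (X N t - X N s) \<le> L * (\<bar>t - s\<bar> + 1 / real N)"
    if N: "N > 0" "1 - real N \<le> s" "s \<le> N" "1 - real N \<le> t" "t \<le> N" for N s t
  proof -
    have "1 / real (q N) \<le> 1 / real N"
      using q[of N] N(1) by (intro divide_left_mono) auto
    then have "\<bar>\<tau> N (ix N t) - \<tau> N (ix N s)\<bar> \<le> \<bar>t - s\<bar> + 1 / real N"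
      using ix(3,4)[OF N(2,3)] ix(3,4)[OF N(4,5)] by (intro abs_leI; linarith)
    then have "L * \<bar>\<tau> N (ix N t) - \<tau> N (ix N s)\<bar> \<le> L * (\<bar>t - s\<bar> + 1 / real N)"
      using L0 by (rule mult_left_mono)
    then show ?thesis
      using zlip[of N "ix N s" "ix N t"] ix N by (auto simp: X_def)
  qed
  obtain k where k: "strict_mono (k :: nat \<Rightarrow> nat)"
    and kc: "\<And>t. t \<in> \<rat> \<Longrightarrow> \<exists>l. (\<lambda>n. X (k n) t) \<longlonglongrightarrow> l"
    using function_convergent_subsequence[OF countable_rat, of X R] XR by metis
  have k_large: "eventually (\<lambda>n. real (k n) \<ge> B) sequentially" for B
  proof -
    have "filterlim (\<lambda>n. real (k n)) at_top sequentially"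
      using filterlim_compose[OF filterlim_real_sequentially filterlim_subseq[OF k]] by (simp add: o_def)
    then show ?thesis by (simp add: filterlim_at_top)
  qed
  \<comment> \<open>Comparison with a rational time within \<open>\<eta>\<close>: two differences
    are below \<open>e / 3\<close> by \<open>Xlip\<close>, the third by convergence at that
    rational.\<close>
  have "Cauchy (\<lambda>n. X (k n) t)" for t
  proof (rule metric_CauchyI)
    fix e :: real assume e: "e > 0"
    define \<eta> where "\<eta> = e / (8 * (L + 1))"
    have \<eta>: "\<eta> > 0" "L * (\<eta> + \<eta>) < e / 3"
      using e L0 by (auto simp: \<eta>_def field_simps add_pos_nonneg)
    obtain s where s: "s \<in> \<rat>" "t - \<eta> < s" "s < t"
      using Rats_dense_in_real[of "t - \<eta>" t] \<eta>(1) by auto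
    have "Cauchy (\<lambda>n. X (k n) s)"
      using kc[OF s(1)] LIMSEQ_imp_Cauchy by blast
    then obtain n1 where n1: "\<And>m n. m \<ge> n1 \<Longrightarrow> n \<ge> n1 \<Longrightarrow> dist (X (k m) s) (X (k n) s) < e / 3"
      using e unfolding Cauchy_def by (metis divide_pos_pos zero_less_numeral)
    obtain n2 where n2: "\<And>n. n \<ge> n2 \<Longrightarrow> real (k n) \<ge> \<bar>t\<bar> + \<bar>s\<bar> + 1 + 1 / \<eta>"
      using k_large[of "\<bar>t\<bar> + \<bar>s\<bar> + 1 + 1 / \<eta>"] by (auto simp: eventually_sequentially)
    have close: "dist (X (k n) t) (X (k n) s) < e / 3" if "n \<ge> n2" for n
    proof -
      have kn: "real (k n) \<ge> \<bar>t\<bar> + \<bar>s\<bar> + 1" "real (k n) \<ge> 1 / \<eta>"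
        using n2[OF that] \<eta>(1) by (auto intro: order_trans[rotated])
      then have "1 / real (k n) \<le> \<eta>" using \<eta>(1) by (auto simp: field_simps)
      have "norm (X (k n) t - X (k n) s) \<le> L * (\<bar>t - s\<bar> + 1 / real (k n))"
        using kn(1) by (intro Xlip) (auto intro: Nat.gr0I)
      also have "\<dots> \<le> L * (\<eta> + \<eta>)"
        using L0 s \<open>1 / real (k n) \<le> \<eta>\<close> by (intro mult_left_mono add_mono) auto
      finally show ?thesis using \<eta>(2) by (simp add: dist_norm)
    qed
    show "\<exists>M. \<forall>m\<ge>M. \<forall>n\<ge>M. dist (X (k m) t) (X (k n) t) < e"
    proof (intro exI allI impI)
      fix m n assume mn: "max n1 n2 \<le> m" "max n1 n2 \<le> n"
      have "dist (X (k m) t) (X (k n) t) \<le> dist (X (k m) t) (X (k m) s) + dist (X (k m) s) (X (k n) s) + dist (X (k n) t) (X (k n) s)"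
        by (smt (verit) dist_triangle dist_commute)
      then show "dist (X (k m) t) (X (k n) t) < e"
        using close[of m] close[of n] n1[of m n] mn by simp
    qed
  qed
  then have "\<exists>l. (\<lambda>n. X (k n) t) \<longlonglongrightarrow> l" for t
    by (simp add: Cauchy_convergent_iff convergent_def)
  then obtain x where x: "\<And>t. (\<lambda>n. X (k n) t) \<longlonglongrightarrow> x t" by metis
  have xR: "norm (x t) \<le> R" for t
    by (rule Lim_bounded[OF tendsto_norm[OF x[of t]], of 0]) (use XR in auto)
  have \<tau>_lim: "(\<lambda>n. \<tau> (k n) (ix (k n) t)) \<longlonglongrightarrow> t" for t
  proof (rule tendsto_sandwich[where f = "\<lambda>n. t - 1 / real (k n)" and h = "\<lambda>_. t"])
    show "\<forall>\<^sub>F n in sequentially. t - 1 / real (k n) \<le> \<tau> (k n) (ix (k n) t)"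
      using k_large[of "\<bar>t\<bar> + 1"]
    proof eventually_elim
      case (elim n)
      then have "1 / real (q (k n)) \<le> 1 / real (k n)"
        using q[of "k n"] by (intro divide_left_mono) auto
      then show ?case using ix(3)[of "k n" t] elim by linarith
    qed
    show "\<forall>\<^sub>F n in sequentially. \<tau> (k n) (ix (k n) t) \<le> t"
      using k_large[of "\<bar>t\<bar> + 1"] by eventually_elim (use ix(4) in force)
    have "filterlim (\<lambda>n. real (k n)) at_top sequentially"
      using k_large by (simp add: filterlim_at_top)
    then have "(\<lambda>n. 1 / real (k n)) \<longlonglongrightarrow> 0"
      by (rule real_tendsto_divide_at_top[OF tendsto_const])
    from tendsto_diff[OF tendsto_const this] show "(\<lambda>n. t - 1 / real (k n)) \<longlonglongrightarrow> t" by simp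
  qed auto
  have deriv: "(x has_vector_derivative f t0 (x t0)) (at t0)" for t0
    unfolding has_vector_derivative_def has_derivative_at_alt
  proof (intro conjI allI impI)
    show "bounded_linear (\<lambda>r. r *\<^sub>R f t0 (x t0))"
      by (rule bounded_linear_scaleR_left)
    fix e :: real assume e: "e > 0"
    let ?v = "f t0 (x t0)"
    obtain \<eta>0 where \<eta>0: "\<eta>0 > 0"
      "\<And>s u. dist (s, u) (t0, x t0) < \<eta>0 \<Longrightarrow> dist (f s u) ?v < e"
      using cont e unfolding continuous_on_iff by (force simp: split_beta)
    \<comment> \<open>For large \<open>n\<close>, nodes in the \<open>\<eta>\<close>-window of
      \<open>t0\<close> are at most \<open>2 * \<eta>\<close> off in time and
      \<open>3 * \<eta> * L + \<eta>0 / 4\<close> off in space; this scale fits both into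
      \<open>\<eta>0\<close>.\<close>
    define \<eta> where "\<eta> = \<eta>0 / (8 * (L + 1))"
    have \<eta>: "\<eta> > 0" "8 * \<eta> + 8 * (\<eta> * L) = \<eta>0" "\<eta> * L \<ge> 0"
    proof -
      have "\<eta> * (8 * (L + 1)) = \<eta>0" using L0 by (simp add: \<eta>_def)
      then show "8 * \<eta> + 8 * (\<eta> * L) = \<eta>0" by (simp add: algebra_simps)
    qed (use \<eta>0(1) L0 in \<open>auto simp: \<eta>_def\<close>)
    \<comment> \<open>\<open>tele\<close> passed to the limit; \<open>s = t0\<close> and
      \<open>t = t0\<close> give the two one-sided derivatives.\<close>
    have key: "norm (x t - x s - (t - s) *\<^sub>R ?v) \<le> e * (t - s)"
      if st: "t0 - \<eta> < s" "s \<le> t" "t < t0 + \<eta>" for s t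
    proof (rule tendsto_le[OF _ _ _ ])
      show "(\<lambda>n. norm (X (k n) t - X (k n) s - (\<tau> (k n) (ix (k n) t) - \<tau> (k n) (ix (k n) s)) *\<^sub>R ?v))
        \<longlonglongrightarrow> norm (x t - x s - (t - s) *\<^sub>R ?v)"
        by (intro tendsto_intros x \<tau>_lim)
      show "(\<lambda>n. e * (\<tau> (k n) (ix (k n) t) - \<tau> (k n) (ix (k n) s))) \<longlonglongrightarrow> e * (t - s)"
        by (intro tendsto_intros \<tau>_lim)
      have "\<forall>\<^sub>F n in sequentially. dist (X (k n) t0) (x t0) < \<eta>0 / 4"
        using x[of t0] \<eta>0(1) by (intro tendstoD) auto
      then show "\<forall>\<^sub>F n in sequentially.
        norm (X (k n) t - X (k n) s - (\<tau> (k n) (ix (k n) t) - \<tau> (k n) (ix (k n) s)) *\<^sub>R ?v)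
        \<le> e * (\<tau> (k n) (ix (k n) t) - \<tau> (k n) (ix (k n) s))"
        using k_large[of "\<bar>t\<bar> + \<bar>s\<bar> + \<bar>t0\<bar> + 1 + 1 / \<eta>"]
      proof eventually_elim
        case (elim n)
        define N where "N = k n"
        have "1 / \<eta> > 0" using \<eta>(1) by simp
        then have N: "real N \<ge> \<bar>t\<bar> + 1" "real N \<ge> \<bar>s\<bar> + 1" "real N \<ge> \<bar>t0\<bar> + 1" "real N \<ge> 1 / \<eta>"
          using elim(2) unfolding N_def by linarith+
        have qN: "1 / real (q N) \<le> \<eta>"
        proof -
          have "real (q N) \<ge> 1 / \<eta>" using N(4) q[of N] by linarith
          then show ?thesis using \<eta>(1) q0[of N] by (auto simp: field_simps)
        qed
        have r: "1 - real N \<le> t" "t \<le> N" "1 - real N \<le> s" "s \<le> N" "1 - real N \<le> t0" "t0 \<le> N"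
          using N by linarith+
        have "norm (z N (ix N t) - z N (ix N s) - (\<tau> N (ix N t) - \<tau> N (ix N s)) *\<^sub>R ?v)
          \<le> e * (\<tau> N (ix N t) - \<tau> N (ix N s))"
        proof (rule tele[OF ix_mono[OF st(2)]])
          fix p assume p: "ix N s \<le> p" "p < ix N t"
          have p': "q N \<le> p" "p \<le> 2 * N * q N" using p ix(1)[OF r(3,4)] ix(2)[OF r(1,2)] by linarith+
          have "\<tau> N (ix N s) \<le> \<tau> N p" "\<tau> N p \<le> \<tau> N (ix N t)"
            using p by (auto simp: \<tau>_def divide_right_mono)
          then have tp: "\<bar>\<tau> N p - t0\<bar> \<le> 2 * \<eta>"
            using ix(3)[OF r(3,4)] ix(4)[OF r(1,2)] st qN by (intro abs_leI; linarith)
          have "\<bar>\<tau> N p - \<tau> N (ix N t0)\<bar> \<le> 3 * \<eta>"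
            using tp ix(3,4)[OF r(5,6)] qN by (intro abs_leI; linarith)
          then have "norm (z N p - z N (ix N t0)) \<le> L * (3 * \<eta>)"
            using zlip[of N "ix N t0" p] p' ix(1,2)[of N t0] r L0
            by (smt (verit, best) mult_left_mono)
          moreover have "dist (z N (ix N t0)) (x t0) < \<eta>0 / 4"
            using elim(1) r by (simp add: X_def N_def)
          ultimately have "dist (z N p) (x t0) < L * (3 * \<eta>) + \<eta>0 / 4"
            using dist_triangle[of "z N p" "x t0" "z N (ix N t0)"] by (simp add: dist_norm)
          moreover have "dist (\<tau> N p, z N p) (t0, x t0) \<le> \<bar>\<tau> N p - t0\<bar> + dist (z N p) (x t0)"
            unfolding dist_Pair_Pair dist_real_def by (rule order_trans[OF sqrt_sum_squares_le_sum_abs]) simp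
          moreover have "L * (3 * \<eta>) = 3 * (\<eta> * L)" by simp
          ultimately have "dist (\<tau> N p, z N p) (t0, x t0) < \<eta>0"
            using tp \<eta> \<eta>0(1) by linarith
          from \<eta>0(2)[OF this] show "norm (f (\<tau> N p) (z N p) - ?v) \<le> e"
            by (simp add: dist_norm)
        qed
        then show ?case using r by (simp add: X_def N_def)
      qed
    qed simp
    show "\<exists>d>0. \<forall>y. norm (y - t0) < d \<longrightarrow> norm (x y - x t0 - (y - t0) *\<^sub>R ?v) \<le> e * norm (y - t0)"
    proof (intro exI[of _ \<eta>] conjI allI impI \<eta>(1))
      fix y assume y: "norm (y - t0) < \<eta>"
      show "norm (x y - x t0 - (y - t0) *\<^sub>R ?v) \<le> e * norm (y - t0)"
      proof (cases "t0 \<le> y")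
        case True
        then show ?thesis using key[of t0 y] y \<eta>(1) by auto
      next
        case False
        have "x y - x t0 - (y - t0) *\<^sub>R ?v = - (x t0 - x y - (t0 - y) *\<^sub>R ?v)"
          by (simp add: algebra_simps)
        then show ?thesis using key[of y t0] y \<eta>(1) False by (simp only: norm_minus_cancel) auto
      qed
    qed
  qed
  show ?thesis
    using xR deriv by (auto simp: solves_on_def)
qed

subsection \<open>Discrete energy estimates\<close>

lemma blinfun_inner_bound:
  fixes S :: "'a::euclidean_space \<Rightarrow>\<^sub>L 'a"
  shows "\<bar>blinfun_apply S x \<bullet> y\<bar> \<le> norm S * norm x * norm y"
  by (rule order_trans[OF Cauchy_Schwarz_ineq2]) (simp add: norm_blinfun mult_right_mono)

text \<open>With \<open>b = \<beta> * c / d\<close> and \<open>\<delta> = h * d / c\<close> the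
  hypotheses give \<open>w (Suc i) \<ge> w i + \<delta> * (\<bar>w i\<bar> - b)\<close>, so
  \<open>w\<close> rises where \<open>\<bar>w i\<bar> > b\<close>. A value above \<open>b\<close>
  persists to \<open>M\<close>, passes to index \<open>0\<close> by \<open>per\<close>, and the
  strict first step then contradicts \<open>per\<close>. If \<open>w\<close> starts below
  \<open>- b\<close> it must stay there, rising, with the same contradiction.\<close>

lemma discrete_energy_bound:
  fixes w r :: "nat \<Rightarrow> real" and M :: nat
  assumes pos: "h > 0" "c > 0" "d > 0" "\<beta> > 0" "M > 0" and hd: "h * d \<le> c"
    and per: "w M \<le> w 0"
    and inc: "\<And>i. i < M \<Longrightarrow> h * (d * (r i)\<^sup>2 - \<beta>) \<le> w (Suc i) - w i"
    and wr: "\<And>i. i \<le> M \<Longrightarrow> \<bar>w i\<bar> \<le> c * (r i)\<^sup>2"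
    and i: "i \<le> M"
  shows "\<bar>w i\<bar> \<le> \<beta> * c / d"
proof -
  define b where "b = \<beta> * c / d"
  define \<delta> where "\<delta> = h * d / c"
  have \<delta>: "\<delta> > 0" "\<delta> \<le> 1" and b: "b > 0" using pos hd by (auto simp: \<delta>_def b_def)
  have up: "w i + \<delta> * (\<bar>w i\<bar> - b) \<le> w (Suc i)" if "i < M" for i
  proof -
    have "\<delta> * \<bar>w i\<bar> \<le> \<delta> * (c * (r i)\<^sup>2)"
      using wr[of i] that \<delta> by (intro mult_left_mono) auto
    moreover have "\<delta> * (c * (r i)\<^sup>2) = h * (d * (r i)\<^sup>2)" "\<delta> * b = h * \<beta>"
      using pos by (auto simp: \<delta>_def b_def)
    ultimately show ?thesis using inc[OF that] by (simp add: algebra_simps)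
  qed
  have grow: "w i \<le> w j" if "b < w i" "i \<le> j" "j \<le> M" for i j
    using that(2,3)
  proof (induction j rule: dec_induct)
    case (step j)
    then have "w i \<le> w j" by simp
    then have "\<bar>w j\<bar> - b \<ge> 0" using that(1) by simp
    then have "\<delta> * (\<bar>w j\<bar> - b) \<ge> 0" using \<delta>(1) by simp
    then show ?case using up[of j] step.prems \<open>w i \<le> w j\<close> by linarith
  qed simp
  have strict: "w 0 < w 1" if "\<bar>w 0\<bar> > b"
  proof -
    have "\<delta> * (\<bar>w 0\<bar> - b) > 0" using \<delta>(1) that by simp
    then show ?thesis using up[of 0] pos(5) by simp
  qed
  \<comment> \<open>Here \<open>\<delta> \<le> 1\<close>, that is \<open>h * d \<le> c\<close>,
    matters: one step from a value at or above \<open>- b\<close> cannot jump below it.\<close>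
  have stay: "- b \<le> w j" if "- b \<le> w i" "i \<le> j" "j \<le> M" for i j
    using that(2,3)
  proof (induction j rule: dec_induct)
    case base
    then show ?case using that(1) by simp
  next
    case (step j)
    then have j: "- b \<le> w j" by simp
    have "- b \<le> w j + \<delta> * (\<bar>w j\<bar> - b)"
    proof (cases "w j \<ge> 0")
      case True
      have "\<delta> * b \<le> 1 * b" using \<delta> b by (intro mult_right_mono) auto
      moreover have "\<delta> * w j \<ge> 0" using \<delta>(1) True by simp
      ultimately show ?thesis using True by (simp add: right_diff_distrib)
    next
      case False
      have "0 \<le> (1 - \<delta>) * (w j + b)" using \<delta> j by (intro mult_nonneg_nonneg) auto
      then show ?thesis using False by (simp add: algebra_simps)
    qed
    then show ?case using up[of j] step.prems by linarith
  qed
  have "w i \<le> b"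
  proof (rule ccontr)
    assume "\<not> w i \<le> b"
    then have "b < w 0" using grow[of i M] i per by simp
    moreover have "w 0 < w 1" using strict calculation by simp
    moreover have "w 1 \<le> w M" using grow[of 1 M] calculation pos(5) by simp
    ultimately show False using per by simp
  qed
  moreover have "- b \<le> w i"
  proof (cases "- b \<le> w 0")
    case True
    then show ?thesis using stay[of 0 i] i by simp
  next
    case False
    have neg: "w j < - b" if "j \<le> M" for j
      using stay[of j M] that per False by force
    have "w 1 \<le> w j" if "1 \<le> j" "j \<le> M" for j
      using that
    proof (induction j rule: dec_induct)
      case (step j)
      have "\<delta> * (\<bar>w j\<bar> - b) \<ge> 0" using neg[of j] step \<delta>(1) b by simp
      then show ?case using up[of j] step by simp
    qed simp
    from this[of M] strict False b per pos(5) show ?thesis by simp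
  qed
  ultimately show ?thesis unfolding b_def[symmetric] by simp
qed

text \<open>The form behind \<open>w\<close> may be indefinite, so a bound on \<open>w\<close> does
  not control \<open>r\<close> at a given index. But if \<open>r\<close> were large throughout
  \<open>q\<close> consecutive steps, that is for unit time, \<open>w\<close> would gain more than
  \<open>2 * b\<close>.\<close>

lemma window_bound:
  fixes w r :: "nat \<Rightarrow> real"
  assumes h: "h * real q = 1" and q: "q > 0" and d: "d > 0"
    and inc: "\<And>i. i < M \<Longrightarrow> h * (d * (r i)\<^sup>2 - \<beta>) \<le> w (Suc i) - w i"
    and w: "\<And>i. i \<le> M \<Longrightarrow> \<bar>w i\<bar> \<le> b" and i: "q \<le> i" "i \<le> M"
  shows "\<exists>j. i - q \<le> j \<and> j < i \<and> (r j)\<^sup>2 \<le> (\<beta> + 2 * b) / d"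
proof (rule ccontr)
  assume no: "\<not> ?thesis"
  have h0: "h > 0" using h q by (metis of_nat_0_less_iff zero_less_mult_pos2 zero_less_one)
  have st: "h * (2 * b) < w (Suc j) - w j" if "i - q \<le> j" "j < i" for j
  proof -
    have "(r j)\<^sup>2 > (\<beta> + 2 * b) / d" using no that by (auto simp: not_le)
    then have "2 * b < d * (r j)\<^sup>2 - \<beta>" using d by (simp add: field_simps)
    then show ?thesis using inc[of j] that i mult_strict_left_mono[OF _ h0] by (meson less_le_trans)
  qed
  have "(\<Sum>j=i-q..<i. h * (2 * b)) < (\<Sum>j=i-q..<i. w (Suc j) - w j)"
    using st q i by (intro sum_strict_mono) auto
  also have "\<dots> = w i - w (i - q)" by (rule sum_Suc_diff') simp
  also have "\<dots> \<le> 2 * b" using w[of i] w[of "i - q"] i by (simp add: abs_le_iff) linarith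
  finally have "real q * (h * (2 * b)) < 2 * b" using i by simp
  moreover have "real q * (h * (2 * b)) = h * real q * (2 * b)" by simp
  ultimately show False by (simp add: h)
qed

text \<open>The system for \<open>y = x / \<phi>\<close>, together with the linear field
  \<open>B\<close> at the other end of the homotopy. \<open>f_growth\<close> and
  \<open>B_growth\<close> bound from below the derivative of \<open>C t y \<bullet> y\<close> along
  \<open>y' = f t y\<close> and \<open>y' = B t y\<close>.\<close>

locale dichotomic_field =
  fixes f :: "real \<Rightarrow> 'a::euclidean_space \<Rightarrow> 'a" and B C C' :: "real \<Rightarrow> ('a \<Rightarrow>\<^sub>L 'a)" and c d m :: real
  assumes f_cont: "continuous_on UNIV (\<lambda>(t, y). f t y)"
    and B_cont: "continuous_on UNIV B"
    and C_deriv: "\<And>t. (C has_vector_derivative C' t) (at t)"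
    and C'_cont: "continuous_on UNIV C'"
    and C_sym: "\<And>t. symmetric_op (C t)"
    and C_bij: "\<And>t. bij (blinfun_apply (C t))"
    and C_norm: "\<And>t. norm (C t) \<le> c"
    and f_norm: "\<And>t y. norm (f t y) \<le> m * norm y + 1"
    and B_norm: "\<And>t. norm (B t) \<le> m"
    and f_growth: "\<And>t y. 2 * (d * (norm y)\<^sup>2 - c * norm y) \<le> 2 * (C t (f t y) \<bullet> y) + C' t y \<bullet> y"
    and B_growth: "\<And>t y. 2 * d * (norm y)\<^sup>2 \<le> 2 * (C t (B t y) \<bullet> y) + C' t y \<bullet> y"
    and c_pos: "c > 0" and d_pos: "d > 0" and m_pos: "m > 0"
begin

text \<open>Found by completing a square in \<open>2 * (d * r\<^sup>2 - c * r) - d / 2 * (r\<^sup>2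
  + 1) \<ge> d * r\<^sup>2 - \<beta>\<close>, where the subtracted term is the allowance for
  discretisation errors.\<close>

definition \<beta> :: real where "\<beta> = 2 * c\<^sup>2 / d + d / 2"

lemma \<beta>_pos: "\<beta> > 0"
  using c_pos d_pos by (auto simp: \<beta>_def intro!: add_nonneg_pos)

lemma C_linearization:
  assumes "\<epsilon> > 0"
  obtains \<delta> where "\<delta> > 0"
    "\<And>t h. \<bar>t\<bar> \<le> T \<Longrightarrow> 0 < h \<Longrightarrow> h \<le> \<delta> \<Longrightarrow> norm (C (t + h) - C t - h *\<^sub>R C' t) \<le> h * \<epsilon>"
proof -
  have "uniformly_continuous_on {-T..T+1} C'"
    by (rule compact_uniformly_continuous[OF continuous_on_subset[OF C'_cont]]) auto
  then obtain \<delta> where \<delta>: "\<delta> > 0"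
    "\<And>s t. s \<in> {-T..T+1} \<Longrightarrow> t \<in> {-T..T+1} \<Longrightarrow> dist s t < \<delta> \<Longrightarrow> dist (C' s) (C' t) < \<epsilon>"
    using assms unfolding uniformly_continuous_on_def by metis
  show ?thesis
  proof (rule that[of "min 1 (\<delta> / 2)"])
    show "min 1 (\<delta> / 2) > 0" using \<delta>(1) by simp
    fix t h :: real assume t: "\<bar>t\<bar> \<le> T" and h: "0 < h" "h \<le> min 1 (\<delta> / 2)"
    have "norm (C (t + h) - C t - (t + h - t) *\<^sub>R C' t) \<le> norm (t + h - t) * \<epsilon>"
    proof (rule vector_differentiable_bound_linearization[where S = "{t..t+h}"])
      fix s assume s: "s \<in> {t..t+h}"
      show "(C has_vector_derivative C' s) (at s within {t..t+h})"
        by (rule has_vector_derivative_at_within[OF C_deriv])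
      have "dist (C' s) (C' t) < \<epsilon>"
        using s t h \<delta>(1) by (intro \<delta>(2)) (auto simp: dist_real_def)
      then show "norm (C' s - C' t) \<le> \<epsilon>" by (simp add: dist_norm)
    qed (use h in \<open>auto simp: closed_segment_eq_real_ivl\<close>)
    then show "norm (C (t + h) - C t - h *\<^sub>R C' t) \<le> h * \<epsilon>" using h by simp
  qed
qed

text \<open>One step changes the form by \<open>h\<close> times its derivative, up to errors that a
  small \<open>h\<close> hides in half of the growth constant \<open>d\<close>. The velocity
  \<open>v\<close> is constrained only by the two inequalities, so that convex combinations of
  \<open>B\<close> and \<open>f\<close> are covered.\<close>

lemma euler_step_energy:
  obtains \<delta> where "\<delta> > 0"
    "\<And>t h y v. \<bar>t\<bar> \<le> T \<Longrightarrow> 0 < h \<Longrightarrow> h \<le> \<delta> \<Longrightarrow> norm v \<le> m * norm y + 1 \<Longrightarrow>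
      2 * (d * (norm y)\<^sup>2 - c * norm y) \<le> 2 * (C t v \<bullet> y) + C' t y \<bullet> y \<Longrightarrow>
      h * (d * (norm y)\<^sup>2 - \<beta>) \<le> C (t + h) (y + h *\<^sub>R v) \<bullet> (y + h *\<^sub>R v) - C t y \<bullet> y"
proof -
  define K where "K = 2 * (m + 1)\<^sup>2"
  have K: "K > 0" using m_pos by (simp add: K_def)
  have "compact ((\<lambda>t. norm (C' t)) ` {-T..T})"
    by (intro compact_continuous_image continuous_intros continuous_on_subset[OF C'_cont]) auto
  then have "bounded ((\<lambda>t. norm (C' t)) ` {-T..T})" by (rule compact_imp_bounded)
  then obtain D where D: "D > 0" "\<And>t. \<bar>t\<bar> \<le> T \<Longrightarrow> norm (C' t) \<le> D"
    unfolding bounded_pos by (auto simp: abs_le_iff minus_le_iff)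
  obtain \<delta>1 where \<delta>1: "\<delta>1 > 0"
    "\<And>t h. \<bar>t\<bar> \<le> T \<Longrightarrow> 0 < h \<Longrightarrow> h \<le> \<delta>1 \<Longrightarrow> norm (C (t + h) - C t - h *\<^sub>R C' t) \<le> h * (d / (16 * K))"
    using C_linearization[of "d / (16 * K)" T] d_pos K by auto
  \<comment> \<open>\<open>\<delta>1\<close> keeps the cost of the remainder \<open>E\<close> below
    \<open>h * (d / 4 * (r\<^sup>2 + 1))\<close>; the last entry does the same for the terms of
    order two and three in \<open>h\<close>, bounded together by
    \<open>h * h * (c + 3 * D) * Q\<close>.\<close>
  define \<delta> where "\<delta> = min (min 1 \<delta>1) (d / (4 * ((c + 3 * D) * K)))"
  have cDK: "(c + 3 * D) * K > 0" using c_pos D(1) K by simp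
  show ?thesis
  proof (rule that)
    show "\<delta> > 0" using \<delta>1(1) cDK d_pos by (simp add: \<delta>_def)
    fix t h :: real and y v :: 'a
    assume t: "\<bar>t\<bar> \<le> T" and h: "0 < h" "h \<le> \<delta>" and v: "norm v \<le> m * norm y + 1"
      and gr: "2 * (d * (norm y)\<^sup>2 - c * norm y) \<le> 2 * (C t v \<bullet> y) + C' t y \<bullet> y"
    define r where "r = norm y"
    define Q where "Q = K * (r\<^sup>2 + 1)"
    have r: "r \<ge> 0" by (simp add: r_def)
    have h1: "h \<le> 1" "h \<le> \<delta>1" "h * ((c + 3 * D) * K) \<le> d / 4"
      using h cDK by (auto simp: \<delta>_def field_simps)
    have vr: "norm v \<le> (m + 1) * (r + 1)"
    proof -
      have "(m + 1) * (r + 1) = m * r + 1 + (m + r)" by (simp add: algebra_simps)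
      then show ?thesis using v r m_pos unfolding r_def by linarith
    qed
    have "(norm v)\<^sup>2 \<le> ((m + 1) * (r + 1))\<^sup>2" using vr by (intro power_mono) auto
    also have "\<dots> = (m + 1)\<^sup>2 * (r + 1)\<^sup>2" by (simp add: power_mult_distrib)
    also have "\<dots> \<le> (m + 1)\<^sup>2 * (2 * (r\<^sup>2 + 1))"
      using sum_squares_bound[of r 1] by (intro mult_left_mono zero_le_power2) (simp add: power2_sum)
    also have "\<dots> = Q" unfolding Q_def K_def by (simp only: mult_ac)
    finally have vQ: "(norm v)\<^sup>2 \<le> Q" .
    have "1 \<le> (m + 1)\<^sup>2" using m_pos by (simp add: one_le_power)
    then have "1 \<le> K" by (simp add: K_def)
    then have "1 * (r\<^sup>2 + 1) \<le> Q" unfolding Q_def by (intro mult_right_mono) auto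
    then have rQ: "r\<^sup>2 \<le> Q" by simp
    have rvQ: "r * norm v \<le> Q"
      using sum_squares_bound[of r "norm v"] vQ rQ by simp
    have Q0: "Q \<ge> 0" using rQ by (rule order_trans[OF zero_le_power2])
    define p where "p = y + h *\<^sub>R v"
    define E where "E = C (t + h) - C t - h *\<^sub>R C' t"
    have p: "(norm p)\<^sup>2 \<le> 4 * Q"
    proof -
      have "h * norm v \<le> 1 * norm v" using h1 by (intro mult_right_mono) auto
      then have "norm p \<le> r + norm v"
        unfolding p_def r_def using h norm_triangle_ineq[of y "h *\<^sub>R v"] by simp
      then have "(norm p)\<^sup>2 \<le> (r + norm v)\<^sup>2" by (intro power_mono) auto
      also have "\<dots> = r\<^sup>2 + (norm v)\<^sup>2 + 2 * (r * norm v)" by (simp add: power2_sum)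
      finally show ?thesis using vQ rQ rvQ by simp
    qed
    have eq: "C (t + h) p \<bullet> p = C t y \<bullet> y + h * (2 * (C t v \<bullet> y) + C' t y \<bullet> y)
      + h * h * (C t v \<bullet> v) + h * h * (C' t v \<bullet> y) + h * h * (C' t y \<bullet> v) + h * (h * h * (C' t v \<bullet> v)) + E p \<bullet> p"
    proof -
      have "C (t + h) p \<bullet> p = C t p \<bullet> p + h * (C' t p \<bullet> p) + E p \<bullet> p"
        by (simp add: E_def blinfun.bilinear_simps inner_diff_left)
      moreover have "C t y \<bullet> v = C t v \<bullet> y"
        using C_sym[of t] unfolding symmetric_op_def by (metis inner_commute)
      ultimately show ?thesis
        by (simp add: p_def blinfun.bilinear_simps inner_add_left inner_add_right algebra_simps)
    qed
    have e1: "\<bar>C t v \<bullet> v\<bar> \<le> c * Q"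
    proof -
      have "\<bar>C t v \<bullet> v\<bar> \<le> norm (C t) * (norm v)\<^sup>2"
        using blinfun_inner_bound[of "C t" v v] by (simp add: power2_eq_square mult.assoc)
      also have "\<dots> \<le> c * Q" using C_norm vQ c_pos by (intro mult_mono) auto
      finally show ?thesis .
    qed
    have e2: "\<bar>C' t v \<bullet> y\<bar> \<le> D * Q"
    proof -
      have "\<bar>C' t v \<bullet> y\<bar> \<le> norm (C' t) * (r * norm v)"
        using blinfun_inner_bound[of "C' t" v y] by (simp add: r_def mult_ac)
      also have "\<dots> \<le> D * Q" using D t rvQ r by (intro mult_mono) auto
      finally show ?thesis .
    qed
    have e3: "\<bar>C' t y \<bullet> v\<bar> \<le> D * Q"
    proof -
      have "\<bar>C' t y \<bullet> v\<bar> \<le> norm (C' t) * (r * norm v)"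
        using blinfun_inner_bound[of "C' t" y v] by (simp add: r_def mult_ac)
      also have "\<dots> \<le> D * Q" using D t rvQ r by (intro mult_mono) auto
      finally show ?thesis .
    qed
    have e4: "h * \<bar>C' t v \<bullet> v\<bar> \<le> D * Q"
    proof -
      have "\<bar>C' t v \<bullet> v\<bar> \<le> norm (C' t) * (norm v)\<^sup>2"
        using blinfun_inner_bound[of "C' t" v v] by (simp add: power2_eq_square mult.assoc)
      also have "\<dots> \<le> D * Q" using D t vQ by (intro mult_mono) auto
      finally have "h * \<bar>C' t v \<bullet> v\<bar> \<le> 1 * (D * Q)" using h h1 by (intro mult_mono) auto
      then show ?thesis by simp
    qed
    have e5: "\<bar>E p \<bullet> p\<bar> \<le> h * (d / 4 * (r\<^sup>2 + 1))"
    proof -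
      have "\<bar>E p \<bullet> p\<bar> \<le> norm E * (norm p)\<^sup>2"
        using blinfun_inner_bound[of E p p] by (simp add: power2_eq_square mult.assoc)
      also have "\<dots> \<le> h * (d / (16 * K)) * (4 * Q)"
        using \<delta>1(2)[OF t h(1) h1(2)] p d_pos K h by (intro mult_mono) (auto simp: E_def)
      also have "\<dots> = h * (d / 4 * (r\<^sup>2 + 1))" using K by (simp add: Q_def)
      finally show ?thesis .
    qed
    have "h * (h * (C t v \<bullet> v + C' t v \<bullet> y + C' t y \<bullet> v + h * (C' t v \<bullet> v))) \<ge> h * (h * (- ((c + 3 * D) * Q)))"
    proof -
      have "\<bar>h * (C' t v \<bullet> v)\<bar> \<le> D * Q" using e4 h by (simp add: abs_mult)
      then have "C t v \<bullet> v + C' t v \<bullet> y + C' t y \<bullet> v + h * (C' t v \<bullet> v) \<ge> - ((c + 3 * D) * Q)"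
        using e1 e2 e3 by (simp add: distrib_right abs_le_iff)
      then show ?thesis using h by (intro mult_left_mono) auto
    qed
    moreover have "h * (h * ((c + 3 * D) * Q)) \<le> h * (d / 4 * (r\<^sup>2 + 1))"
    proof -
      have "h * ((c + 3 * D) * K) * (r\<^sup>2 + 1) \<le> d / 4 * (r\<^sup>2 + 1)"
        using h1(3) by (intro mult_right_mono) auto
      then show ?thesis using h by (intro mult_left_mono) (auto simp: Q_def mult_ac)
    qed
    moreover have "h * (2 * (C t v \<bullet> y) + C' t y \<bullet> y) \<ge> h * (2 * (d * r\<^sup>2 - c * r))"
      using gr h by (intro mult_left_mono) (auto simp: r_def)
    ultimately have "C (t + h) p \<bullet> p - C t y \<bullet> y \<ge> h * (2 * (d * r\<^sup>2 - c * r)) - 2 * (h * (d / 4 * (r\<^sup>2 + 1)))"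
      using e5 unfolding eq by (simp add: algebra_simps abs_le_iff)
    also have "h * (2 * (d * r\<^sup>2 - c * r)) - 2 * (h * (d / 4 * (r\<^sup>2 + 1)))
      = h * (2 * (d * r\<^sup>2 - c * r) - d / 2 * (r\<^sup>2 + 1))" by (simp add: algebra_simps)
    moreover have "2 * (d * r\<^sup>2 - c * r) - d / 2 * (r\<^sup>2 + 1) \<ge> d * r\<^sup>2 - \<beta>"
    proof -
      have "0 \<le> (d * r - 2 * c)\<^sup>2 / (2 * d)" using d_pos by simp
      also have "\<dots> = d / 2 * r\<^sup>2 - 2 * c * r + 2 * c\<^sup>2 / d"
        using d_pos by (simp add: power2_eq_square field_simps)
      finally show ?thesis by (simp add: \<beta>_def algebra_simps)
    qed
    then have "h * (2 * (d * r\<^sup>2 - c * r) - d / 2 * (r\<^sup>2 + 1)) \<ge> h * (d * r\<^sup>2 - \<beta>)"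
      using h by (intro mult_left_mono) auto
    ultimately show "h * (d * (norm y)\<^sup>2 - \<beta>) \<le> C (t + h) (y + h *\<^sub>R v) \<bullet> (y + h *\<^sub>R v) - C t y \<bullet> y"
      unfolding p_def r_def by linarith
  qed
qed

end

subsection \<open>Existence of a bounded solution\<close>

context dichotomic_field begin

lemma C_cont: "continuous_on UNIV C"
  using C_deriv by (auto intro!: continuous_at_imp_continuous_on has_vector_derivative_continuous)

text \<open>Free of \<open>N\<close>: by \<open>window_bound\<close> every unit window contains a
  node with squared norm at most \<open>(\<beta> + 2 * (\<beta> * c / d)) / d\<close>, and in the
  next unit of time the speed bound \<open>m * norm y + 1\<close> allows the factor
  \<open>exp m\<close> and the summand \<open>1\<close>.\<close>

definition radius :: real where "radius = exp m * (sqrt ((\<beta> + 2 * (\<beta> * c / d)) / d) + 1)"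

text \<open>Nodes of the polygon from \<open>\<xi>\<close> at time \<open>-N\<close> with step
  \<open>h\<close>; \<open>l\<close> deforms the field from the linear \<open>B\<close> to
  \<open>f\<close>.\<close>

definition euler :: "real \<Rightarrow> nat \<Rightarrow> real \<Rightarrow> 'a \<Rightarrow> nat \<Rightarrow> 'a" where
  "euler h N l \<xi> = rec_nat \<xi> (\<lambda>i z. z + h *\<^sub>R ((1 - l) *\<^sub>R B (real i * h - real N) z + l *\<^sub>R f (real i * h - real N) z))"

lemma euler_0 [simp]: "euler h N l \<xi> 0 = \<xi>"
  by (simp add: euler_def)

lemma euler_Suc [simp]:
  "euler h N l \<xi> (Suc i) = euler h N l \<xi> i + h *\<^sub>R ((1 - l) *\<^sub>R B (real i * h - real N) (euler h N l \<xi> i)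
     + l *\<^sub>R f (real i * h - real N) (euler h N l \<xi> i))"
  by (simp add: euler_def)

lemma continuous_on_euler: "continuous_on S (\<lambda>(l, \<xi>). euler h N l \<xi> i)"
proof (induction i)
  case 0
  then show ?case by (simp add: split_beta continuous_intros)
next
  case (Suc i)
  then have E: "continuous_on S (\<lambda>p. euler h N (fst p) (snd p) i)" by (simp add: split_beta)
  have "continuous_on S (\<lambda>p. case (t, euler h N (fst p) (snd p) i) of (t, y) \<Rightarrow> f t y)" for t
    by (rule continuous_on_compose2[OF f_cont]) (auto intro!: continuous_intros E)
  then show ?case
    by (simp add: split_beta) (intro continuous_intros E; simp)
qed

lemma linear_euler: "linear (\<lambda>\<xi>. euler h N 0 \<xi> i)"
proof (induction i)
  case (Suc i)
  have "linear (\<lambda>\<xi>. B t (euler h N 0 \<xi> i))" for t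
    using linear_compose[OF Suc bounded_linear.linear[OF blinfun.bounded_linear_right]] by (simp add: o_def)
  then show ?case
    by (simp add: linear_compose_add linear_compose_scale_right Suc)
qed (simp add: linear_id[unfolded id_def])

text \<open>Closed polygons are the zeros of \<open>P l\<close>. These are bounded uniformly in
  \<open>l\<close>, so \<open>zero_of_homotopy_to_linear\<close> yields one for
  \<open>l = 1\<close>; its energy bound then gives a norm bound free of \<open>N\<close>.\<close>

lemma periodic_euler_orbit:
  "\<exists>q z. q > N \<and> (\<forall>i. z (Suc i) = z i + (1 / real q) *\<^sub>R f (real i / real q - real N) (z i)) \<and>
     (\<forall>i. q \<le> i \<longrightarrow> i \<le> 2 * N * q \<longrightarrow> norm (z i) \<le> radius)"
proof (cases "N = 0")
  case True
  \<comment> \<open>With \<open>N = 0\<close> and \<open>q = 1\<close> the index range of the bound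
    is empty, so any polygon will do.\<close>
  have "euler 1 0 1 0 (Suc i) = euler 1 0 1 0 i + f (real i) (euler 1 0 1 0 i)" for i by simp
  then show ?thesis
    using True by (intro exI[of _ 1] exI[of _ "euler 1 0 1 0"]) auto
next
  case False
  obtain \<delta> where \<delta>: "\<delta> > 0"
    "\<And>t h y v. \<bar>t\<bar> \<le> real N \<Longrightarrow> 0 < h \<Longrightarrow> h \<le> \<delta> \<Longrightarrow> norm v \<le> m * norm y + 1 \<Longrightarrow>
      2 * (d * (norm y)\<^sup>2 - c * norm y) \<le> 2 * (C t v \<bullet> y) + C' t y \<bullet> y \<Longrightarrow>
      h * (d * (norm y)\<^sup>2 - \<beta>) \<le> C (t + h) (y + h *\<^sub>R v) \<bullet> (y + h *\<^sub>R v) - C t y \<bullet> y"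
    using euler_step_energy by blast
  \<comment> \<open>The three bounds give \<open>q > N\<close>, \<open>h \<le> \<delta>\<close> for
    the energy step, and \<open>h * d \<le> c\<close> for
    \<open>discrete_energy_bound\<close>.\<close>
  obtain q :: nat where q: "real q > max (real N) (max (1 / \<delta>) (d / c))"
    using reals_Archimedean2 by blast
  have q0: "q > 0" "q > N" using q False by auto
  define h where "h = 1 / real q"
  have h: "h > 0" "h \<le> \<delta>" "h * d \<le> c" "h * real q = 1"
    using q q0 \<delta>(1) c_pos by (auto simp: h_def field_simps)
  define M where "M = 2 * N * q"
  have M: "M > 0" using q0 False by (simp add: M_def)
  obtain S :: "'a \<Rightarrow>\<^sub>L 'a" where S: "\<And>x. C (real N) x \<bullet> x \<le> C (- real N) (blinfun_apply S x) \<bullet> blinfun_apply S x"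
    using symmetric_path_form_le[OF C_cont C_sym C_bij, where t = "real N" and s = "- real N"] by blast
  \<comment> \<open>At a zero, the start of the polygon is \<open>S\<close> applied to its end, so
    by the choice of \<open>S\<close> the final energy is at most the initial one.\<close>
  define P where "P = (\<lambda>l \<xi>. \<xi> - blinfun_apply S (euler h N l \<xi> M))"
  define w where "w = (\<lambda>l \<xi> i. C (real i * h - real N) (euler h N l \<xi> i) \<bullet> euler h N l \<xi> i)"
  have MhN: "real M * h = 2 * real N" using q0 by (simp add: M_def h_def)
  have inc: "h * (d * (norm (euler h N l \<xi> i))\<^sup>2 - \<beta>) \<le> w l \<xi> (Suc i) - w l \<xi> i"
    if l: "l \<in> {0..1}" and i: "i < M" for l \<xi> i
  proof -
    let ?t = "real i * h - real N" and ?y = "euler h N l \<xi> i"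
    let ?v = "(1 - l) *\<^sub>R B ?t ?y + l *\<^sub>R f ?t ?y"
    have "real i * h \<le> real M * h" "real i * h \<ge> 0" using i h(1) by (auto intro!: mult_right_mono)
    then have t: "\<bar>?t\<bar> \<le> real N" unfolding MhN by (intro abs_leI) linarith+
    have "norm (B ?t ?y) \<le> m * norm ?y"
      by (rule order_trans[OF norm_blinfun mult_right_mono[OF B_norm norm_ge_zero]])
    then have n: "norm ?v \<le> (1 - l) * (m * norm ?y) + l * (m * norm ?y + 1)"
      using l f_norm[of ?t ?y]
      by (intro norm_triangle_mono) (auto intro!: mult_left_mono)
    have g: "2 * (C ?t ?v \<bullet> ?y) + C' ?t ?y \<bullet> ?y
      = (1 - l) * (2 * (C ?t (B ?t ?y) \<bullet> ?y) + C' ?t ?y \<bullet> ?y) + l * (2 * (C ?t (f ?t ?y) \<bullet> ?y) + C' ?t ?y \<bullet> ?y)"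
      by (simp add: blinfun.bilinear_simps inner_add_left algebra_simps)
    have "(1 - l) * (2 * d * (norm ?y)\<^sup>2) + l * (2 * (d * (norm ?y)\<^sup>2 - c * norm ?y))
      \<le> 2 * (C ?t ?v \<bullet> ?y) + C' ?t ?y \<bullet> ?y"
      unfolding g using l by (intro add_mono mult_left_mono B_growth f_growth) auto
    moreover have "l * (c * norm ?y) \<le> 1 * (c * norm ?y)"
      using l c_pos by (intro mult_right_mono) auto
    ultimately have g2: "2 * (d * (norm ?y)\<^sup>2 - c * norm ?y) \<le> 2 * (C ?t ?v \<bullet> ?y) + C' ?t ?y \<bullet> ?y"
      by (simp add: algebra_simps)
    have "norm ?v \<le> m * norm ?y + 1" using n l by (simp add: algebra_simps)
    from \<delta>(2)[OF t h(1,2) this g2] show ?thesis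
      by (simp add: w_def algebra_simps)
  qed
  have closed: "w l \<xi> M \<le> w l \<xi> 0" if "P l \<xi> = 0" for l \<xi>
  proof -
    have "\<xi> = blinfun_apply S (euler h N l \<xi> M)" using that by (simp add: P_def)
    then show ?thesis using S[of "euler h N l \<xi> M"] MhN by (simp add: w_def)
  qed
  \<comment> \<open>A crude radius, growing with \<open>M\<close>, that suffices for the homotopy:
    sum \<open>inc\<close> over all steps and keep only the square at \<open>i = 0\<close>.\<close>
  define R where "R = sqrt (real M * \<beta> / d) + 1"
  have R: "R > 0" using \<beta>_pos d_pos by (simp add: R_def add_nonneg_pos)
  have zero_small: "norm \<xi> < R" if "l \<in> {0..1}" "P l \<xi> = 0" for l \<xi>
  proof -
    have "h * (d * (norm \<xi>)\<^sup>2) - h * (real M * \<beta>) \<le> (\<Sum>i<M. h * (d * (norm (euler h N l \<xi> i))\<^sup>2 - \<beta>))"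
    proof -
      have "(\<Sum>i\<in>{0}. d * (norm (euler h N l \<xi> i))\<^sup>2) \<le> (\<Sum>i<M. d * (norm (euler h N l \<xi> i))\<^sup>2)"
        using M d_pos by (intro sum_mono2) auto
      then show ?thesis
        using h(1) by (simp add: sum_distrib_left[symmetric] sum_subtractf right_diff_distrib[symmetric])
    qed
    also have "\<dots> \<le> (\<Sum>i<M. w l \<xi> (Suc i) - w l \<xi> i)"
      using inc[OF that(1)] by (intro sum_mono) auto
    also have "\<dots> = w l \<xi> M - w l \<xi> 0" by (rule sum_lessThan_telescope)
    finally have "h * (d * (norm \<xi>)\<^sup>2) \<le> h * (real M * \<beta>)" using closed[OF that(2)] by simp
    then have "(norm \<xi>)\<^sup>2 \<le> real M * \<beta> / d" using h(1) d_pos by (simp add: field_simps)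
    then have "norm \<xi> \<le> sqrt (real M * \<beta> / d)" by (rule real_le_rsqrt)
    then show ?thesis by (simp add: R_def)
  qed
  have lin: "linear (P 0)"
    unfolding P_def
    using linear_compose[OF linear_euler bounded_linear.linear[OF blinfun.bounded_linear_right]]
    by (intro linear_compose_sub linear_id[unfolded id_def]) (simp add: o_def)
  have "inj (P 0)"
    unfolding linear_injective_0[OF lin]
  proof (intro allI impI)
    fix \<xi> assume "P 0 \<xi> = 0"
    \<comment> \<open>A nonzero kernel element rescaled to norm \<open>R\<close> would violate
      \<open>zero_small\<close>.\<close>
    then have "P 0 ((R / norm \<xi>) *\<^sub>R \<xi>) = 0" by (simp add: linear_cmul[OF lin])
    then have "norm ((R / norm \<xi>) *\<^sub>R \<xi>) < R" by (intro zero_small) auto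
    then show "\<xi> = 0" using R by (auto split: if_splits)
  qed
  moreover have "continuous_on ({0..1} \<times> UNIV) (\<lambda>(l, \<xi>). P l \<xi>)"
    unfolding P_def split_beta
    by (intro continuous_intros continuous_on_euler[unfolded split_beta])
  ultimately have "\<exists>\<xi>. P 1 \<xi> = 0"
    by (intro zero_of_homotopy_to_linear[where P = P, OF _ lin _ R]) (use zero_small in fastforce)+
  then obtain \<xi> where \<xi>: "P 1 \<xi> = 0" by blast
  define z where "z = euler h N 1 \<xi>"
  have z: "z (Suc i) = z i + h *\<^sub>R f (real i * h - real N) (z i)" for i
    by (simp add: z_def)
  have wc: "\<bar>w 1 \<xi> i\<bar> \<le> c * (norm (z i))\<^sup>2" for i
  proof -
    have "\<bar>w 1 \<xi> i\<bar> \<le> norm (C (real i * h - real N)) * (norm (z i))\<^sup>2"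
      unfolding w_def z_def by (rule order_trans[OF blinfun_inner_bound]) (simp add: power2_eq_square)
    also have "\<dots> \<le> c * (norm (z i))\<^sup>2" by (intro mult_right_mono C_norm) auto
    finally show ?thesis .
  qed
  have incz: "h * (d * (norm (z i))\<^sup>2 - \<beta>) \<le> w 1 \<xi> (Suc i) - w 1 \<xi> i" if "i < M" for i
    using inc[of 1 i \<xi>] that by (simp add: z_def)
  have wb: "\<bar>w 1 \<xi> i\<bar> \<le> \<beta> * c / d" if "i \<le> M" for i
    by (rule discrete_energy_bound[where r = "\<lambda>i. norm (z i)" and w = "w 1 \<xi>", OF h(1) c_pos d_pos \<beta>_pos M h(3) closed[OF \<xi>] incz wc that])
  \<comment> \<open>Discrete Gronwall inequality; for \<open>real p * h \<le> 1\<close> the power is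
    at most \<open>exp m\<close>.\<close>
  have grow: "norm (z (j + p)) \<le> (1 + h * m) ^ p * (norm (z j) + real p * h)" for j p
  proof (induction p)
    case (Suc p)
    have hm: "1 \<le> 1 + h * m" using h(1) m_pos by simp
    have "norm (z (j + Suc p)) \<le> norm (z (j + p)) + h * (m * norm (z (j + p)) + 1)"
    proof -
      have "h * norm (f (real (j + p) * h - real N) (z (j + p))) \<le> h * (m * norm (z (j + p)) + 1)"
        using h(1) by (intro mult_left_mono f_norm) auto
      moreover have "norm (z (j + Suc p)) \<le> norm (z (j + p)) + norm (h *\<^sub>R f (real (j + p) * h - real N) (z (j + p)))"
        by (simp only: add_Suc_right z norm_triangle_ineq)
      moreover have "norm (h *\<^sub>R f (real (j + p) * h - real N) (z (j + p)))
          = h * norm (f (real (j + p) * h - real N) (z (j + p)))"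
        using h(1) by simp
      ultimately show ?thesis
        by linarith
    qed
    also have "\<dots> = (1 + h * m) * norm (z (j + p)) + h" by (simp add: algebra_simps)
    also have "\<dots> \<le> (1 + h * m) * ((1 + h * m) ^ p * (norm (z j) + real p * h)) + h * (1 + h * m) ^ Suc p"
    proof (intro add_mono mult_left_mono Suc)
      show "h \<le> h * (1 + h * m) ^ Suc p"
        using one_le_power[OF hm, of "Suc p"] h(1) by simp
    qed (use hm in auto)
    finally show ?case by (simp add: algebra_simps)
  qed simp
  have "norm (z i) \<le> radius" if i: "q \<le> i" "i \<le> M" for i
  proof -
    define K where "K = (\<beta> + 2 * (\<beta> * c / d)) / d"
    obtain j where j: "i - q \<le> j" "j < i" "(norm (z j))\<^sup>2 \<le> K"
      using window_bound[where r = "\<lambda>i. norm (z i)" and w = "w 1 \<xi>", OF h(4) q0(1) d_pos incz wb i]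
      unfolding K_def by blast
    have zj: "norm (z j) \<le> sqrt K" using j(3) by (rule real_le_rsqrt)
    define p where "p = i - j"
    have p: "i = j + p" "p \<le> q" using j by (auto simp: p_def)
    have ph: "real p * h \<le> 1" using p(2) h by (metis mult.commute mult_right_mono of_nat_le_iff less_imp_le)
    have "(1 + h * m) ^ p \<le> exp (h * m) ^ p"
      using h(1) m_pos by (intro power_mono exp_ge_add_one_self) auto
    also have "\<dots> = exp (real p * h * m)" by (simp add: exp_of_nat_mult mult.assoc)
    also have "\<dots> \<le> exp m" using ph m_pos by (simp add: mult_le_cancel_right1)
    finally have "(1 + h * m) ^ p \<le> exp m" .
    then have "(1 + h * m) ^ p * (norm (z j) + real p * h) \<le> exp m * (sqrt K + 1)"
      using zj ph h(1) by (intro mult_mono add_mono) auto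
    then show ?thesis using grow[of j p] unfolding p(1) radius_def K_def by linarith
  qed
  then show ?thesis
    using z q0 by (intro exI[of _ q] exI[of _ z]) (auto simp: h_def M_def)
qed

lemma bounded_solution_exists: "\<exists>x. (\<forall>t. norm (x t) \<le> radius) \<and> solves_on f UNIV x"
proof -
  obtain q z where qz: "\<And>N. q N > N"
    "\<And>N i. z N (Suc i) = z N i + (1 / real (q N)) *\<^sub>R f (real i / real (q N) - real N) (z N i)"
    "\<And>N i. q N \<le> i \<Longrightarrow> i \<le> 2 * N * q N \<Longrightarrow> norm (z N i) \<le> radius"
    using periodic_euler_orbit by metis
  show ?thesis
  proof (rule euler_polygons_limit[OF f_cont qz])
    fix t :: real and y :: 'a assume "norm y \<le> radius"
    then have "m * norm y \<le> m * radius" using m_pos by (intro mult_left_mono) auto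
    then show "norm (f t y) \<le> m * radius + 1" using f_norm[of t y] by linarith
  qed
qed

end

subsection \<open>A priori estimate and uniqueness\<close>

lemma F_main_has_derivative:
  assumes "m > 0" "r \<ge> 0"
  shows "(F_main c d m has_real_derivative 2 * r * (d * r - c) / (m * r + 1)) (at r)"
proof -
  have p: "m * r + 1 > 0" using assms by (simp add: add_nonneg_pos)
  have "(F_main c d m has_real_derivative
      d / m * (2 * r) + 2 * (c / m + d / m\<^sup>2) * (1 / m * (1 / (m * r + 1) * m) - 1)) (at r)"
    unfolding F_main_def[abs_def] using p by (auto intro!: derivative_eq_intros)
  moreover have "d / m * (2 * r) + 2 * (c / m + d / m\<^sup>2) * (1 / m * (1 / (m * r + 1) * m) - 1)
      = 2 * r * (d * r - c) / (m * r + 1)"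
    using p assms(1) by (simp add: divide_simps power2_eq_square) (simp add: algebra_simps)
  ultimately show ?thesis by simp
qed

lemma F_main_strict_mono:
  assumes "m > 0" "c > 0" "d > 0" "c / d \<le> r" "r < s"
  shows "F_main c d m r < F_main c d m s"
proof (rule DERIV_pos_imp_increasing_open[OF assms(5)])
  have r: "r > 0" by (rule less_le_trans[OF divide_pos_pos[OF assms(2,3)] assms(4)])
  fix x assume x: "r < x" "x < s"
  have "c / d < x" using assms(4) x by simp
  then have "c < d * x" using assms(3) by (simp add: pos_divide_less_eq mult.commute)
  then have "2 * x * (d * x - c) / (m * x + 1) > 0"
    using r x assms(1) by (auto intro!: divide_pos_pos mult_pos_pos add_pos_pos)
  then show "\<exists>y. DERIV (F_main c d m) x :> y \<and> y > 0"
    using F_main_has_derivative[of m x c d] r x assms(1) by (meson less_imp_le less_trans)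
next
  have r: "r > 0" by (rule less_le_trans[OF divide_pos_pos[OF assms(2,3)] assms(4)])
  then show "continuous_on {r..s} (F_main c d m)"
    by (intro continuous_at_imp_continuous_on ballI DERIV_isCont[OF F_main_has_derivative]) (use assms in auto)
qed

lemma F_main_at_top:
  assumes "m > 0" "d > 0"
  shows "filterlim (F_main c d m) at_top at_top"
  unfolding F_main_def[abs_def] using assms by real_asymp

text \<open>Beyond \<open>c / d\<close> the derivative is positive and \<open>F_main\<close> is
  unbounded, so the intermediate value theorem gives existence and strict monotonicity
  uniqueness.\<close>

lemma F_fun_root:
  assumes pos: "m > 0" "c > 0" "d > 0" and "\<Lambda> \<ge> 0"
  shows "\<exists>!r. r \<ge> c / d \<and> F_fun c d m r = F_fun c d m (c / d) + \<Lambda>"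
proof (rule ex_ex1I)
  have "eventually (\<lambda>r. F_main c d m r \<ge> F_main c d m (c / d) + \<Lambda>) at_top"
    using F_main_at_top[OF pos(1,3)] by (simp add: filterlim_at_top)
  then have "eventually (\<lambda>r. F_main c d m r \<ge> F_main c d m (c / d) + \<Lambda> \<and> r \<ge> c / d) at_top"
    using eventually_ge_at_top[of "c / d"] by eventually_elim simp
  then obtain R where R: "F_main c d m R \<ge> F_main c d m (c / d) + \<Lambda>" "R \<ge> c / d"
    by (auto simp: eventually_at_top_linorder)
  have cd: "c / d > 0" using pos by simp
  have "\<exists>r\<ge>c / d. r \<le> R \<and> F_main c d m r = F_main c d m (c / d) + \<Lambda>"
  proof (rule IVT')
    show "continuous_on {c / d..R} (F_main c d m)"
    proof (intro continuous_at_imp_continuous_on ballI DERIV_isCont[OF F_main_has_derivative])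
      fix x assume "x \<in> {c / d..R}"
      then show "0 \<le> x" using cd by auto
    qed (rule pos(1))
  qed (use R assms in auto)
  then show "\<exists>r. r \<ge> c / d \<and> F_fun c d m r = F_fun c d m (c / d) + \<Lambda>"
    by (auto simp: F_fun_def)
next
  fix r s
  assume "c / d \<le> r \<and> F_fun c d m r = F_fun c d m (c / d) + \<Lambda>"
    and "c / d \<le> s \<and> F_fun c d m s = F_fun c d m (c / d) + \<Lambda>"
  then have "c / d \<le> r" "c / d \<le> s" "F_main c d m r = F_main c d m s"
    by (auto simp: F_fun_def)
  then show "r = s"
    using F_main_strict_mono[OF pos, of r s] F_main_strict_mono[OF pos, of s r] by (cases r s rule: linorder_cases) auto
qed

section \<open>Crossing times and derivatives along curves\<close>

lemma first_hit:
  fixes \<rho> :: "real \<Rightarrow> real"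
  assumes cont: "continuous_on UNIV \<rho>" and e: "e < \<rho> t0" and s: "t0 \<le> s" "\<rho> s \<le> e"
  obtains u where "t0 < u" "\<rho> u = e" "\<And>v. t0 \<le> v \<Longrightarrow> v \<le> u \<Longrightarrow> e \<le> \<rho> v"
proof -
  define S where "S = {v. t0 \<le> v \<and> \<rho> v \<le> e}"
  have S: "closed S" "S \<noteq> {}" "bdd_below S"
    using s by (auto simp: S_def intro!: closed_Collect_conj closed_Collect_le continuous_intros cont bdd_belowI[of _ t0])
  define u where "u = Inf S"
  have u: "t0 \<le> u" "\<rho> u \<le> e"
    using closed_contains_Inf[OF S(2,3,1)] by (auto simp: S_def u_def)
  have before: "e < \<rho> v" if "t0 \<le> v" "v < u" for v
    using cInf_lower[OF _ S(3), of v] that by (force simp: S_def u_def)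
  obtain v where v: "t0 \<le> v" "v \<le> u" "\<rho> v = e"
    using IVT2'[of \<rho> u e t0] u e continuous_on_subset[OF cont] by auto
  then have "v = u" using before[of v] by force
  then show ?thesis
    using that[of u] v before u e by (metis less_eq_real_def order_less_irrefl)
qed

text \<open>A derivative of at least \<open>\<kappa>\<close> on an interval of length
  \<open>(2 * K + 1) / \<kappa>\<close> would raise \<open>w\<close> by \<open>2 * K + 1\<close>,
  more than its oscillation.\<close>

lemma bounded_derivative_not_large:
  fixes w w' :: "real \<Rightarrow> real"
  assumes deriv: "\<And>t. (w has_real_derivative w' t) (at t)" and bd: "\<And>t. \<bar>w t\<bar> \<le> K" and \<kappa>: "\<kappa> > 0"
  shows "\<exists>s\<ge>t0. w' s < \<kappa>" and "\<exists>s\<le>t0. w' s < \<kappa>"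
proof -
  have K: "K \<ge> 0" using bd[of 0] by simp
  have *: "\<exists>s>a. s < a + (2 * K + 1) / \<kappa> \<and> w' s < \<kappa>" for a
  proof -
    let ?T = "(2 * K + 1) / \<kappa>"
    have T: "?T > 0" using K \<kappa> by (simp add: add_nonneg_pos)
    obtain s where s: "a < s" "s < a + ?T" "w (a + ?T) - w a = (a + ?T - a) * w' s"
      using MVT2[of a "a + ?T" w w'] T deriv by auto
    have "?T * w' s \<le> 2 * K" using s(3) bd[of a] bd[of "a + ?T"] by (simp add: abs_le_iff)
    also have "\<dots> < ?T * \<kappa>" using \<kappa> by simp
    finally have "w' s < \<kappa>" using T mult_less_cancel_left_pos by blast
    then show ?thesis using s by blast
  qed
  show "\<exists>s\<ge>t0. w' s < \<kappa>" using *[of t0] by (auto intro: less_imp_le)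
  \<comment> \<open>The interval is shifted back by its own length so that it ends at
    \<open>t0\<close>.\<close>
  show "\<exists>s\<le>t0. w' s < \<kappa>" using *[of "t0 - (2 * K + 1) / \<kappa>"] by (auto intro: less_imp_le)
qed

lemma quadratic_form_has_derivative:
  fixes C C' :: "real \<Rightarrow> ('a::euclidean_space \<Rightarrow>\<^sub>L 'a)" and y :: "real \<Rightarrow> 'a"
  assumes C: "(C has_vector_derivative C' t) (at t)" and y: "(y has_vector_derivative v) (at t)"
    and sym: "symmetric_op (C t)"
  shows "((\<lambda>t. C t (y t) \<bullet> y t) has_real_derivative 2 * (C t v \<bullet> y t) + C' t (y t) \<bullet> y t) (at t)"
proof -
  have "((\<lambda>t. C t (y t)) has_vector_derivative C t v + C' t (y t)) (at t)"
    using bounded_bilinear.has_vector_derivative[OF bounded_bilinear_blinfun_apply C y] by simp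
  from bounded_bilinear.has_vector_derivative[OF bounded_bilinear_inner this y]
  have "((\<lambda>t. C t (y t) \<bullet> y t) has_vector_derivative C t (y t) \<bullet> v + (C t v + C' t (y t)) \<bullet> y t) (at t)" .
  moreover have "C t (y t) \<bullet> v = C t v \<bullet> y t"
    using sym unfolding symmetric_op_def by (metis inner_commute)
  ultimately show ?thesis
    by (simp add: has_real_derivative_iff_has_vector_derivative inner_add_left algebra_simps)
qed

lemma norm_has_derivative:
  fixes y :: "real \<Rightarrow> 'a::euclidean_space"
  assumes y: "(y has_vector_derivative v) (at t)" and nz: "y t \<noteq> 0"
  shows "((\<lambda>t. norm (y t)) has_real_derivative (v \<bullet> y t) / norm (y t)) (at t)"
proof -
  from bounded_bilinear.has_vector_derivative[OF bounded_bilinear_inner y y]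
  have "((\<lambda>t. y t \<bullet> y t) has_real_derivative y t \<bullet> v + v \<bullet> y t) (at t)"
    by (simp add: has_real_derivative_iff_has_vector_derivative)
  then have "((\<lambda>t. sqrt (y t \<bullet> y t)) has_real_derivative inverse (sqrt (y t \<bullet> y t)) / 2 * (y t \<bullet> v + v \<bullet> y t)) (at t)"
    using nz by (intro DERIV_chain2[OF DERIV_real_sqrt]) auto
  then show ?thesis
    by (simp add: norm_eq_sqrt_inner[symmetric] inner_commute field_simps)
qed

text \<open>For \<open>w = C t u \<bullet> u\<close> the growth condition gives
  \<open>w' \<ge> (2 * d / c) * \<bar>w\<bar>\<close>, so \<open>w\<close> is nondecreasing. A
  nonzero value keeps \<open>w'\<close> above a positive constant on a half-line, forward if it is
  positive and backward if negative, which boundedness forbids.\<close>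

lemma bounded_solution_zero:
  fixes C C' :: "real \<Rightarrow> ('a::euclidean_space \<Rightarrow>\<^sub>L 'a)" and u v :: "real \<Rightarrow> 'a"
  assumes C: "\<And>t. (C has_vector_derivative C' t) (at t)" and u: "\<And>t. (u has_vector_derivative v t) (at t)"
    and sym: "\<And>t. symmetric_op (C t)" and C_norm: "\<And>t. norm (C t) \<le> c"
    and bd: "\<And>t. norm (u t) \<le> K" and pos: "c > 0" "d > 0"
    and growth: "\<And>t. 2 * d * (norm (u t))\<^sup>2 \<le> 2 * (C t (v t) \<bullet> u t) + C' t (u t) \<bullet> u t"
  shows "u t = 0"
proof (rule ccontr)
  assume nz: "u t \<noteq> 0"
  define w where "w = (\<lambda>t. C t (u t) \<bullet> u t)"
  define w' where "w' = (\<lambda>t. 2 * (C t (v t) \<bullet> u t) + C' t (u t) \<bullet> u t)"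
  have w: "(w has_real_derivative w' t) (at t)" for t
    unfolding w_def w'_def by (rule quadratic_form_has_derivative[OF C u sym])
  have wc: "\<bar>w t\<bar> \<le> c * (norm (u t))\<^sup>2" for t
    unfolding w_def
    by (rule order_trans[OF blinfun_inner_bound])
       (simp add: C_norm power2_eq_square mult.assoc mult_right_mono)
  have wK: "\<bar>w t\<bar> \<le> c * K\<^sup>2" for t
    by (rule order_trans[OF wc]) (use pos bd in \<open>auto intro!: mult_left_mono power_mono\<close>)
  have ww: "2 * d / c * \<bar>w t\<bar> \<le> w' t" for t
  proof -
    have "2 * d / c * \<bar>w t\<bar> \<le> 2 * d / c * (c * (norm (u t))\<^sup>2)"
      using pos by (intro mult_left_mono wc) auto
    also have "\<dots> \<le> w' t" using growth[of t] pos by (simp add: w'_def)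
    finally show ?thesis .
  qed
  have mono: "w r \<le> w s" if "r \<le> s" for r s
  proof (rule DERIV_nonneg_imp_nondecreasing[OF that])
    fix x
    have "0 \<le> w' x" by (rule order_trans[OF _ ww]) (use pos in auto)
    then show "\<exists>y. DERIV w x :> y \<and> 0 \<le> y" using w by blast
  qed
  \<comment> \<open>An indefinite form may vanish at \<open>u t\<close> although
    \<open>u t \<noteq> 0\<close>, but \<open>w' t > 0\<close> keeps \<open>w\<close> from vanishing
    identically.\<close>
  have "\<exists>s. w s \<noteq> 0"
  proof (rule ccontr)
    assume "\<nexists>s. w s \<noteq> 0"
    then have "w = (\<lambda>_. 0)" by auto
    then have "w' t = 0" using w[of t] DERIV_unique[OF _ DERIV_const] by metis
    moreover have "2 * d * (norm (u t))\<^sup>2 > 0" using pos nz by simp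
    ultimately show False using growth[of t] by (simp add: w'_def)
  qed
  then obtain s where s: "w s \<noteq> 0" by blast
  define \<kappa> where "\<kappa> = 2 * d / c * \<bar>w s\<bar>"
  have \<kappa>: "\<kappa> > 0" using pos s by (simp add: \<kappa>_def)
  have far: "\<kappa> \<le> w' r" if "\<bar>w s\<bar> \<le> \<bar>w r\<bar>" for r
    unfolding \<kappa>_def by (rule order_trans[OF mult_left_mono[OF that] ww]) (use pos in simp)
  show False
  proof (cases "w s > 0")
    case True
    obtain r where "r \<ge> s" "w' r < \<kappa>" using bounded_derivative_not_large(1)[OF w wK \<kappa>] by blast
    then show ?thesis using far[of r] mono[of s r] True by simp
  next
    case False
    obtain r where "r \<le> s" "w' r < \<kappa>" using bounded_derivative_not_large(2)[OF w wK \<kappa>] by blast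
    then show ?thesis using far[of r] mono[of r s] False by simp
  qed
qed

context dichotomic_field begin

text \<open>While \<open>\<rho> = \<parallel>y\<parallel>\<close> exceeds \<open>c/d\<close>, both \<open>w - F(\<rho>)\<close> and \<open>w + F(\<rho>)\<close> are nondecreasing, where
  \<open>w = \<langle>C y, y\<rangle>\<close>. The estimate adds the two inequalities between \<open>t0\<close> and the nearest times before and
  after it at which \<open>\<rho> = e\<close>; these exist because \<open>w\<close> is bounded.\<close>

lemma excursion_bound:
  assumes sol: "solves_on f UNIV y" and bd: "\<And>t. norm (y t) \<le> K"
    and \<Lambda>: "\<And>s t x x'. s \<le> t \<Longrightarrow> norm x = norm x' \<Longrightarrow> C t x \<bullet> x - C s x' \<bullet> x' \<le> \<Lambda> * (norm x)\<^sup>2"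
    and e: "c / d < e" "e < norm (y t0)"
  shows "2 * (F_main c d m (norm (y t0)) - F_main c d m e) \<le> \<Lambda> * e\<^sup>2"
proof -
  define \<rho> where "\<rho> = (\<lambda>t. norm (y t))"
  define w where "w = (\<lambda>t. C t (y t) \<bullet> y t)"
  define w' where "w' = (\<lambda>t. 2 * (C t (f t (y t)) \<bullet> y t) + C' t (y t) \<bullet> y t)"
  have y: "(y has_vector_derivative f t (y t)) (at t)" for t
    using sol by (simp add: solves_on_def)
  have cd: "0 < c / d" using c_pos d_pos by simp
  have e0: "e > 0" using e cd by linarith
  have dce: "d * r - c > 0" if "c / d < r" for r using that d_pos by (simp add: field_simps)
  have w: "(w has_real_derivative w' t) (at t)" for t
    unfolding w_def w'_def by (rule quadratic_form_has_derivative[OF C_deriv y C_sym])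
  have w'_ge: "2 * \<rho> t * (d * \<rho> t - c) \<le> w' t" for t
    using f_growth[of "y t" t] by (simp add: w'_def \<rho>_def power2_eq_square algebra_simps)
  have wK: "\<bar>w t\<bar> \<le> c * K\<^sup>2" for t
  proof -
    have "\<bar>w t\<bar> \<le> norm (C t) * norm (y t) * norm (y t)" unfolding w_def by (rule blinfun_inner_bound)
    also have "\<dots> \<le> c * K * K" using c_pos C_norm bd order_trans[OF norm_ge_zero bd[of t]] by (intro mult_mono) auto
    finally show ?thesis by (simp add: power2_eq_square mult.assoc)
  qed
  have \<rho>_cont: "continuous_on UNIV \<rho>"
    unfolding \<rho>_def
    by (intro continuous_on_norm continuous_at_imp_continuous_on ballI has_vector_derivative_continuous[OF y])
  \<comment> \<open>A lower bound for \<open>w'\<close> wherever \<open>\<rho> > e\<close>, positive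
    because \<open>e\<close> lies strictly above \<open>c / d\<close>; boundedness of
    \<open>w\<close> then forces \<open>\<rho>\<close> down to \<open>e\<close> in both time
    directions.\<close>
  define \<kappa> where "\<kappa> = 2 * e * (d * e - c)"
  have \<kappa>: "\<kappa> > 0" using e0 dce[OF e(1)] by (simp add: \<kappa>_def)
  have small: "\<rho> s \<le> e" if "w' s < \<kappa>" for s
  proof (rule ccontr)
    assume "\<not> \<rho> s \<le> e"
    then have "\<kappa> \<le> 2 * \<rho> s * (d * \<rho> s - c)"
      unfolding \<kappa>_def using e0 dce[OF e(1)] d_pos by (intro mult_mono) auto
    then show False using w'_ge[of s] that by linarith
  qed
  obtain s2 where "t0 \<le> s2" "\<rho> s2 \<le> e"
    using bounded_derivative_not_large(1)[OF w wK \<kappa>] small by blast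
  then obtain t2 where t2: "t0 < t2" "\<rho> t2 = e" "\<And>v. t0 \<le> v \<Longrightarrow> v \<le> t2 \<Longrightarrow> e \<le> \<rho> v"
    using first_hit[OF \<rho>_cont, of e t0] e(2) unfolding \<rho>_def by blast
  obtain s1 where s1: "s1 \<le> t0" "\<rho> s1 \<le> e"
    using bounded_derivative_not_large(2)[OF w wK \<kappa>] small by blast
  \<comment> \<open>The crossing before \<open>t0\<close> is found by reversing time.\<close>
  have "continuous_on UNIV (\<lambda>t. \<rho> (- t))"
    by (rule continuous_on_compose2[OF \<rho>_cont]) (auto intro: continuous_intros)
  then obtain u where u: "- t0 < u" "\<rho> (- u) = e" "\<And>v. - t0 \<le> v \<Longrightarrow> v \<le> u \<Longrightarrow> e \<le> \<rho> (- v)"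
    using first_hit[of "\<lambda>t. \<rho> (- t)" e "- t0" "- s1"] s1 e(2) unfolding \<rho>_def by auto
  define t1 where "t1 = - u"
  have t1: "t1 < t0" "\<rho> t1 = e" "\<And>v. t1 \<le> v \<Longrightarrow> v \<le> t0 \<Longrightarrow> e \<le> \<rho> v"
    using u(1,2) u(3)[of "- v" for v] by (auto simp: t1_def)
  \<comment> \<open>Chain rule for \<open>F_main\<close> along \<open>\<rho>\<close>. The bound
    \<open>m * \<rho> t + 1\<close> on the speed of \<open>\<rho>\<close> cancels the denominator,
    leaving exactly the lower bound of \<open>w'\<close>.\<close>
  define D where "D = (\<lambda>t. 2 * \<rho> t * (d * \<rho> t - c) / (m * \<rho> t + 1) * ((f t (y t) \<bullet> y t) / \<rho> t))"
  have FD: "((\<lambda>t. F_main c d m (\<rho> t)) has_real_derivative D t) (at t)" "\<bar>D t\<bar> \<le> w' t" if "e \<le> \<rho> t" for t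
  proof -
    have nz: "\<rho> t > 0" using that e0 by linarith
    then have "((\<lambda>t. \<rho> t) has_real_derivative (f t (y t) \<bullet> y t) / \<rho> t) (at t)"
      unfolding \<rho>_def by (intro norm_has_derivative y) auto
    from DERIV_chain2[OF F_main_has_derivative this, of m c d]
    show "((\<lambda>t. F_main c d m (\<rho> t)) has_real_derivative D t) (at t)"
      unfolding D_def using m_pos nz by (simp add: less_imp_le)
    have q: "0 \<le> 2 * \<rho> t * (d * \<rho> t - c)" using nz dce[of "\<rho> t"] that e by auto
    have mp: "m * \<rho> t + 1 > 0" using m_pos nz by (simp add: add_pos_pos)
    have "\<bar>f t (y t) \<bullet> y t\<bar> \<le> (m * \<rho> t + 1) * \<rho> t"
      by (rule order_trans[OF Cauchy_Schwarz_ineq2])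
         (use f_norm[of t "y t"] in \<open>auto simp: \<rho>_def intro!: mult_right_mono\<close>)
    then have "\<bar>f t (y t) \<bullet> y t\<bar> / \<rho> t \<le> m * \<rho> t + 1" using nz by (simp add: pos_divide_le_eq)
    then have "2 * \<rho> t * (d * \<rho> t - c) / (m * \<rho> t + 1) * (\<bar>f t (y t) \<bullet> y t\<bar> / \<rho> t)
        \<le> 2 * \<rho> t * (d * \<rho> t - c) / (m * \<rho> t + 1) * (m * \<rho> t + 1)"
      using q mp by (intro mult_left_mono divide_nonneg_pos) auto
    also have "\<dots> = 2 * \<rho> t * (d * \<rho> t - c)" using mp by simp
    also note w'_ge[of t]
    also have "2 * \<rho> t * (d * \<rho> t - c) / (m * \<rho> t + 1) * (\<bar>f t (y t) \<bullet> y t\<bar> / \<rho> t) = \<bar>D t\<bar>"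
    proof -
      have "\<bar>2 * \<rho> t * (d * \<rho> t - c) / (m * \<rho> t + 1)\<bar> = 2 * \<rho> t * (d * \<rho> t - c) / (m * \<rho> t + 1)"
        using q mp by (intro abs_of_nonneg divide_nonneg_pos)
      then show ?thesis unfolding D_def abs_mult[of "2 * \<rho> t * (d * \<rho> t - c) / (m * \<rho> t + 1)"]
        using nz by (simp only: abs_divide abs_of_pos)
    qed
    finally show "\<bar>D t\<bar> \<le> w' t" .
  qed
  have "w t1 - F_main c d m (\<rho> t1) \<le> w t0 - F_main c d m (\<rho> t0)"
  proof (rule DERIV_nonneg_imp_nondecreasing[where f = "\<lambda>t. w t - F_main c d m (\<rho> t)"])
    fix x assume "t1 \<le> x" "x \<le> t0"
    then have "e \<le> \<rho> x" by (rule t1(3))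
    note FD[OF this]
    then show "\<exists>z. DERIV (\<lambda>t. w t - F_main c d m (\<rho> t)) x :> z \<and> 0 \<le> z"
      by (intro exI[of _ "w' x - D x"] conjI DERIV_diff w) auto
  qed (use t1 in simp)
  moreover have "w t0 + F_main c d m (\<rho> t0) \<le> w t2 + F_main c d m (\<rho> t2)"
  proof (rule DERIV_nonneg_imp_nondecreasing[where f = "\<lambda>t. w t + F_main c d m (\<rho> t)"])
    fix x assume "t0 \<le> x" "x \<le> t2"
    then have "e \<le> \<rho> x" by (rule t2(3))
    note FD[OF this]
    then show "\<exists>z. DERIV (\<lambda>t. w t + F_main c d m (\<rho> t)) x :> z \<and> 0 \<le> z"
      by (intro exI[of _ "w' x + D x"] conjI DERIV_add w) auto
  qed (use t2 in simp)
  \<comment> \<open>\<open>\<Lambda>\<close> applies because both ends of the excursion have norm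
    \<open>e\<close>.\<close>
  moreover have "w t2 - w t1 \<le> \<Lambda> * e\<^sup>2"
    using \<Lambda>[of t1 t2 "y t2" "y t1"] t1(1,2) t2(1,2) by (simp add: w_def \<rho>_def)
  ultimately show ?thesis
    using t1(2) t2(2) by (simp add: \<rho>_def)
qed

text \<open>\<open>excursion_bound\<close> needs a level strictly above \<open>c / d\<close>;
  letting it decrease to \<open>c / d\<close> turns half of the right side into the last term of the
  root equation, and strict monotonicity of \<open>F_main\<close> excludes a norm above
  \<open>r\<close>.\<close>

lemma bounded_solution_estimate:
  assumes sol: "solves_on f UNIV y" and bd: "\<And>t. norm (y t) \<le> K"
    and \<Lambda>: "\<And>s t x x'. s \<le> t \<Longrightarrow> norm x = norm x' \<Longrightarrow> C t x \<bullet> x - C s x' \<bullet> x' \<le> \<Lambda> * (norm x)\<^sup>2"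
    and r: "c / d \<le> r" "F_main c d m r = F_main c d m (c / d) + c\<^sup>2 / (2 * d\<^sup>2) * \<Lambda>"
  shows "norm (y t) \<le> r"
proof (rule ccontr)
  assume "\<not> norm (y t) \<le> r"
  then have rt: "r < norm (y t)" by simp
  have cd: "0 < c / d" using c_pos d_pos by simp
  have "2 * (F_main c d m (norm (y t)) - F_main c d m (c / d)) \<le> \<Lambda> * (c / d)\<^sup>2"
  proof (rule tendsto_le[where F = "at_right (c / d)"])
    have "isCont (F_main c d m) (c / d)"
      by (rule DERIV_isCont[OF F_main_has_derivative[OF m_pos less_imp_le[OF cd]]])
    then have "(F_main c d m \<longlongrightarrow> F_main c d m (c / d)) (at_right (c / d))"
      using filterlim_at_split isCont_def by blast
    then show "((\<lambda>e. 2 * (F_main c d m (norm (y t)) - F_main c d m e)) \<longlongrightarrow>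
        2 * (F_main c d m (norm (y t)) - F_main c d m (c / d))) (at_right (c / d))"
      by (intro tendsto_intros)
    show "((\<lambda>e. \<Lambda> * e\<^sup>2) \<longlongrightarrow> \<Lambda> * (c / d)\<^sup>2) (at_right (c / d))"
      by (intro tendsto_intros)
    have "eventually (\<lambda>e. e \<in> {c / d<..<norm (y t)}) (at_right (c / d))"
      using rt r(1) by (intro eventually_at_right_real) simp
    then show "\<forall>\<^sub>F e in at_right (c / d). 2 * (F_main c d m (norm (y t)) - F_main c d m e) \<le> \<Lambda> * e\<^sup>2"
      by eventually_elim (rule excursion_bound[OF sol bd \<Lambda>], auto)
  qed simp
  then have "F_main c d m (norm (y t)) \<le> F_main c d m r"
    unfolding r(2) by (simp add: power_divide field_simps)
  then show False
    using F_main_strict_mono[OF m_pos c_pos d_pos r(1) rt] by simp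
qed

end

subsection \<open>Reduction to the normalised system\<close>

lemma abs_quadratic_form_le:
  fixes S :: "'a::euclidean_space \<Rightarrow>\<^sub>L 'a"
  shows "\<bar>blinfun_apply S x \<bullet> x\<bar> \<le> norm S * (norm x)\<^sup>2"
  using blinfun_inner_bound[of S x x] by (simp add: power2_eq_square mult.assoc)

lemma lambda_bounds:
  fixes S :: "'a::euclidean_space \<Rightarrow>\<^sub>L 'a"
  assumes S: "norm S \<le> c"
  shows "lambda_minus S * (norm x)\<^sup>2 \<le> blinfun_apply S x \<bullet> x"
    and "blinfun_apply S x \<bullet> x \<le> lambda_plus S * (norm x)\<^sup>2"
    and "- c \<le> lambda_minus S" and "lambda_minus S \<le> lambda_plus S" and "lambda_plus S \<le> c"
proof -
  have b: "\<bar>blinfun_apply S u \<bullet> u\<bar> \<le> c" if "u \<in> sphere 0 1" for u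
    using abs_quadratic_form_le[of S u] S that by simp
  have bdd: "bdd_above ((\<lambda>u. blinfun_apply S u \<bullet> u) ` sphere 0 1)"
    "bdd_below ((\<lambda>u. blinfun_apply S u \<bullet> u) ` sphere 0 1)"
    using b by (auto intro!: bdd_aboveI[of _ c] bdd_belowI[of _ "- c"] simp: abs_le_iff minus_le_iff)
  obtain u :: 'a where u: "u \<in> sphere 0 1" using vector_choose_size[of 1] by auto
  have lam: "lambda_minus S \<le> blinfun_apply S v \<bullet> v" "blinfun_apply S v \<bullet> v \<le> lambda_plus S"
    if "v \<in> sphere 0 1" for v
    unfolding lambda_minus_def lambda_plus_def
    using that bdd by (auto intro: cINF_lower cSUP_upper)
  show "lambda_minus S \<le> lambda_plus S" using lam[OF u] by linarith
  show "- c \<le> lambda_minus S" unfolding lambda_minus_def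
    using u b by (intro cINF_greatest) (auto simp: abs_le_iff minus_le_iff)
  show "lambda_plus S \<le> c" unfolding lambda_plus_def
    using u b by (intro cSUP_least) (auto simp: abs_le_iff)
  have "lambda_minus S * (norm x)\<^sup>2 \<le> blinfun_apply S x \<bullet> x \<and> blinfun_apply S x \<bullet> x \<le> lambda_plus S * (norm x)\<^sup>2"
  proof (cases "x = 0")
    case False
    define v where "v = x /\<^sub>R norm x"
    have "v \<in> sphere 0 1" using False by (simp add: v_def)
    moreover have "blinfun_apply S x \<bullet> x = (blinfun_apply S v \<bullet> v) * (norm x)\<^sup>2"
    proof -
      have "x = norm x *\<^sub>R v" using False by (simp add: v_def)
      then have "blinfun_apply S x \<bullet> x = blinfun_apply S (norm x *\<^sub>R v) \<bullet> (norm x *\<^sub>R v)" by simp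
      then show ?thesis by (simp add: blinfun.scaleR_right power2_eq_square)
    qed
    ultimately show ?thesis using lam by (auto intro!: mult_right_mono)
  qed simp
  then show "lambda_minus S * (norm x)\<^sup>2 \<le> blinfun_apply S x \<bullet> x"
    and "blinfun_apply S x \<bullet> x \<le> lambda_plus S * (norm x)\<^sup>2" by auto
qed

definition spread :: "(real \<Rightarrow> ('a::euclidean_space \<Rightarrow>\<^sub>L 'a)) \<Rightarrow> real" where
  "spread C = (SUP t. (SUP s\<in>{t..}. lambda_plus (C s)) - (INF s\<in>{..t}. lambda_minus (C s)))"

text \<open>The bound \<open>c\<close> makes all suprema and infima genuine. For
  \<open>s \<le> t\<close> the bracket at time \<open>s\<close> already dominates
  \<open>lambda_plus (C t) - lambda_minus (C s)\<close>, since \<open>t\<close> lies in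
  \<open>{s..}\<close> and \<open>s\<close> in \<open>{..s}\<close>.\<close>

lemma spread_bounds:
  fixes C :: "real \<Rightarrow> ('a::euclidean_space \<Rightarrow>\<^sub>L 'a)"
  assumes C: "\<And>t. norm (C t) \<le> c"
  shows "spread C \<ge> 0"
    and "s \<le> t \<Longrightarrow> norm x = norm x' \<Longrightarrow>
      blinfun_apply (C t) x \<bullet> x - blinfun_apply (C s) x' \<bullet> x' \<le> spread C * (norm x)\<^sup>2"
proof -
  have lb: "- c \<le> lambda_minus (C t)" "lambda_minus (C t) \<le> c" "- c \<le> lambda_plus (C t)" "lambda_plus (C t) \<le> c" for t
    using lambda_bounds(3-5)[OF C[of t]] by linarith+
  let ?P = "\<lambda>t. SUP s\<in>{t..}. lambda_plus (C s)" and ?M = "\<lambda>t. INF s\<in>{..t}. lambda_minus (C s)"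
  have P: "lambda_plus (C s) \<le> ?P t" if "t \<le> s" for s t
    using that lb by (intro cSUP_upper bdd_aboveI[of _ c]) auto
  have M: "?M t \<le> lambda_minus (C s)" if "s \<le> t" for s t
    using that lb by (intro cINF_lower bdd_belowI[of _ "- c"]) auto
  have "?P t \<le> c" "- c \<le> ?M t" for t
    using lb by (auto intro!: cSUP_least cINF_greatest)
  then have "?P t - ?M t \<le> 2 * c" for t using diff_mono[of "?P t" c "- c" "?M t"] by simp
  then have sp: "?P t - ?M t \<le> spread C" for t
    unfolding spread_def by (intro cSUP_upper bdd_aboveI[of _ "2 * c"]) auto
  have key: "lambda_plus (C t) - lambda_minus (C s) \<le> spread C" if "s \<le> t" for s t
    using sp[of s] P[OF that] M[of s s] by simp
  show "spread C \<ge> 0" using key[of 0 0] lambda_bounds(4)[OF C[of 0]] by simp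
  assume st: "s \<le> t" and n: "norm x = norm x'"
  have "blinfun_apply (C t) x \<bullet> x - blinfun_apply (C s) x' \<bullet> x'
      \<le> lambda_plus (C t) * (norm x)\<^sup>2 - lambda_minus (C s) * (norm x)\<^sup>2"
    using lambda_bounds(2)[OF C, of t x] lambda_bounds(1)[OF C, of s x'] n by simp
  also have "\<dots> \<le> spread C * (norm x)\<^sup>2"
    using key[OF st] by (simp add: left_diff_distrib[symmetric] mult_right_mono)
  finally show "blinfun_apply (C t) x \<bullet> x - blinfun_apply (C s) x' \<bullet> x' \<le> spread C * (norm x)\<^sup>2" .
qed

section \<open>Passage between \<open>x\<close> and \<open>x / \<phi>\<close>\<close>

lemma has_vector_derivative_quotient:
  fixes x :: "real \<Rightarrow> 'a::real_normed_vector"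
  assumes x: "(x has_vector_derivative v) (at t)" and \<phi>: "(\<phi> has_vector_derivative p) (at t)" and nz: "\<phi> t \<noteq> 0"
  shows "((\<lambda>t. x t /\<^sub>R \<phi> t) has_vector_derivative v /\<^sub>R \<phi> t - (p / \<phi> t) *\<^sub>R (x t /\<^sub>R \<phi> t)) (at t)"
proof -
  have "((\<lambda>t. inverse (\<phi> t)) has_real_derivative - (inverse (\<phi> t) * p * inverse (\<phi> t))) (at t)"
    using \<phi> nz by (intro DERIV_inverse') (simp_all add: has_real_derivative_iff_has_vector_derivative)
  from has_vector_derivative_scaleR[OF this x] show ?thesis
    by (simp add: algebra_simps divide_inverse)
qed

theorem theorem3:
  fixes A C :: "real \<Rightarrow> ('a::euclidean_space \<Rightarrow>\<^sub>L 'a)"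
    and g :: "real \<Rightarrow> 'a \<Rightarrow> 'a"
    and \<phi> :: "real \<Rightarrow> real"
    and a c k l d m :: real
  assumes uniq: "uniqueness_property (rhs A g)"
    and A_cont: "continuous_on UNIV A"
    and A_bdd: "bdd_above (range (\<lambda>t. norm (A t)))"
    and a_def: "a = (SUP t. norm (A t))"
    and dich: "dichotomy_witness A C"
    and c_def: "c = (SUP t. norm (C t))"
    and k_pos: "k > 0"
    and \<phi>_C1: "\<phi> C1_differentiable_on UNIV"
    and \<phi>_pos: "\<And>t. \<phi> t > 0"
    and \<phi>_bdd: "bdd_above (range (\<lambda>t. \<bar>deriv \<phi> t\<bar> / \<phi> t))"
    and l_def: "l = (SUP t. \<bar>deriv \<phi> t\<bar> / \<phi> t)"
    and g_cont: "continuous_on UNIV (\<lambda>(t, x). g t x)"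
    and g_bound: "\<And>t x. norm (g t x) \<le> k * norm x + \<phi> t"
    and d_def: "d = 1 / 2 - c * (k + l)"
    and m_def: "m = a + k + l"
    and small: "c * (k + l) < 1 / 2"
  shows "\<exists>r xs. is_root C c d m r \<and> (\<forall>r'. is_root C c d m r' \<longrightarrow> r' = r) \<and>
      solves_on (rhs A g) UNIV xs \<and> (\<forall>t. norm (xs t) \<le> r * \<phi> t) \<and>
      ((\<forall>t x y. norm (g t x - g t y) \<le> k * norm (x - y)) \<longrightarrow>
        (\<forall>y. solves_on (rhs A g) UNIV y \<and> bdd_above (range (\<lambda>t. norm (y t) / \<phi> t)) \<longrightarrow> y = xs))"
proof -
  obtain \<phi>' where \<phi>': "\<And>t. (\<phi> has_vector_derivative \<phi>' t) (at t)" and \<phi>'_cont: "continuous_on UNIV \<phi>'"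
    using \<phi>_C1 unfolding C1_differentiable_on_def by auto
  have deriv_\<phi>: "deriv \<phi> t = \<phi>' t" for t
    using \<phi>'[of t] by (intro DERIV_imp_deriv) (simp add: has_real_derivative_iff_has_vector_derivative)
  obtain C' where C': "\<And>t. (C has_vector_derivative C' t) (at t)" and C'_cont: "continuous_on UNIV C'"
    using dich unfolding dichotomy_witness_def C1_differentiable_on_def by auto
  have dich': "(norm x)\<^sup>2 \<le> 2 * (C t (A t x) \<bullet> x) + C' t x \<bullet> x" for t x
  proof -
    have "(norm x)\<^sup>2 \<le> blinfun_apply (2 *\<^sub>R (C t o\<^sub>L A t) + vector_derivative C (at t)) x \<bullet> x"
      using dich unfolding dichotomy_witness_def by blast
    then show ?thesis
      by (simp add: vector_derivative_at[OF C'] blinfun.bilinear_simps inner_add_left)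
  qed
  have C_sym: "symmetric_op (C t)" for t
    using dich by (simp add: dichotomy_witness_def property_a_def)
  have C_bij: "bij (blinfun_apply (C t))" for t
    using dich by (auto simp: dichotomy_witness_def Aut_def)
  have C_norm: "norm (C t) \<le> c" for t
    using dich unfolding c_def dichotomy_witness_def by (intro cSUP_upper) auto
  have A_norm: "norm (A t) \<le> a" for t
    unfolding a_def using A_bdd by (intro cSUP_upper) auto
  define \<psi> where "\<psi> = (\<lambda>t. \<phi>' t / \<phi> t)"
  have \<psi>_le: "\<bar>\<psi> t\<bar> \<le> l" for t
  proof -
    have "\<bar>deriv \<phi> t\<bar> / \<phi> t \<le> l" unfolding l_def using \<phi>_bdd by (intro cSUP_upper) auto
    then show ?thesis using \<phi>_pos[of t] by (simp add: \<psi>_def deriv_\<phi>)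
  qed
  have l0: "l \<ge> 0" using \<psi>_le[of 0] by linarith
  have a0: "a \<ge> 0" using A_norm[of 0] norm_ge_zero[of "A 0"] by linarith
  have m_pos: "m > 0" using a0 l0 k_pos by (simp add: m_def)
  have d_pos: "d > 0" using small by (simp add: d_def)
  have c_pos: "c > 0"
  proof -
    obtain u :: 'a where u: "norm u = 1" using vector_choose_size[of 1] by auto
    obtain v where "C 0 v = u" using C_bij[of 0] by (metis bij_pointE)
    then have "C 0 \<noteq> 0" using u by auto
    then show ?thesis using C_norm[of 0] by (metis less_le_trans zero_less_norm_iff)
  qed
  have \<phi>_cont: "continuous_on UNIV \<phi>"
    by (intro continuous_at_imp_continuous_on ballI has_vector_derivative_continuous[OF \<phi>'])
  have \<phi>_nz: "\<phi> t \<noteq> 0" for t using \<phi>_pos[of t] by simp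
  \<comment> \<open>Differentiating \<open>y = x / \<phi>\<close> adds the term
    \<open>- \<psi> t *\<^sub>R y\<close>, where \<open>\<psi>\<close> is the logarithmic derivative
    of \<open>\<phi>\<close>, bounded by \<open>l\<close>.\<close>
  define B where "B = (\<lambda>t. A t - \<psi> t *\<^sub>R id_blinfun)"
  define f where "f = (\<lambda>t y. B t y + g t (\<phi> t *\<^sub>R y) /\<^sub>R \<phi> t)"
  have \<psi>_cont: "continuous_on UNIV \<psi>"
    unfolding \<psi>_def by (intro continuous_intros \<phi>'_cont \<phi>_cont) (simp add: \<phi>_nz)
  have B_cont: "continuous_on UNIV B"
    unfolding B_def by (intro continuous_intros A_cont \<psi>_cont)
  have f_cont: "continuous_on UNIV (\<lambda>(t, y). f t y)"
  proof -
    have c1: "continuous_on UNIV (\<lambda>p::real \<times> 'a. h (fst p))" if "continuous_on UNIV h" for h :: "real \<Rightarrow> 'b::topological_space"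
      by (rule continuous_on_compose2[OF that]) (auto intro: continuous_intros)
    have "continuous_on UNIV (\<lambda>p::real \<times> 'a. case (fst p, \<phi> (fst p) *\<^sub>R snd p) of (t, x) \<Rightarrow> g t x)"
      by (rule continuous_on_compose2[OF g_cont]) (auto intro!: continuous_intros c1[OF \<phi>_cont])
    then show ?thesis
      unfolding f_def split_beta by (simp add: \<phi>_nz) (intro continuous_intros c1 B_cont \<phi>_cont; simp add: \<phi>_nz)
  qed
  have C_C: "\<bar>C t x \<bullet> y\<bar> \<le> c * norm x * norm y" for t x y
    by (rule order_trans[OF blinfun_inner_bound]) (intro mult_right_mono C_norm norm_ge_zero)
  \<comment> \<open>The \<open>\<psi>\<close> term costs at most \<open>2 * c * l\<close> of the
    dichotomy constant \<open>1\<close>. The linear part of the bound on \<open>g\<close> will cost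
    another \<open>2 * c * k\<close>, leaving \<open>2 * d\<close>.\<close>
  have B_form: "2 * (C t (B t y) \<bullet> y) + C' t y \<bullet> y \<ge> (1 - 2 * c * l) * (norm y)\<^sup>2" for t y
  proof -
    have "\<bar>\<psi> t * (C t y \<bullet> y)\<bar> \<le> l * (c * norm y * norm y)"
      unfolding abs_mult by (intro mult_mono \<psi>_le C_C) (use l0 in auto)
    then have "\<psi> t * (C t y \<bullet> y) \<le> l * c * (norm y)\<^sup>2" by (simp add: power2_eq_square mult_ac abs_le_iff)
    moreover have "C t (B t y) \<bullet> y = C t (A t y) \<bullet> y - \<psi> t * (C t y \<bullet> y)"
      by (simp add: B_def blinfun.bilinear_simps inner_diff_left)
    ultimately show ?thesis using dich'[of y t] by (simp add: algebra_simps)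
  qed
  have B_norm: "norm (B t) \<le> a + l" for t
  proof -
    have "norm (\<psi> t *\<^sub>R (id_blinfun :: 'a \<Rightarrow>\<^sub>L 'a)) \<le> l"
      using \<psi>_le[of t] by simp
    then show ?thesis
      unfolding B_def using norm_triangle_ineq4[of "A t" "\<psi> t *\<^sub>R id_blinfun"] A_norm[of t] by linarith
  qed
  have By_norm: "norm (B t y) \<le> (a + l) * norm y" for t y
    by (rule order_trans[OF norm_blinfun mult_right_mono[OF B_norm norm_ge_zero]])
  have g_norm: "norm (g t (\<phi> t *\<^sub>R y) /\<^sub>R \<phi> t) \<le> k * norm y + 1" for t y
  proof -
    have "norm (g t (\<phi> t *\<^sub>R y)) \<le> (k * norm y + 1) * \<phi> t"
      using g_bound[of t "\<phi> t *\<^sub>R y"] \<phi>_pos[of t] by (simp add: algebra_simps)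
    then show ?thesis using \<phi>_pos[of t] by (simp add: pos_divide_le_eq divide_inverse_commute[symmetric])
  qed
  interpret dichotomic_field f B C C' c d m
  proof
    show "norm (f t y) \<le> m * norm y + 1" for t y
      unfolding f_def m_def
      using norm_triangle_ineq[of "B t y" "g t (\<phi> t *\<^sub>R y) /\<^sub>R \<phi> t"] By_norm[of t y] g_norm[of t y]
      by (simp add: distrib_right)
    show "norm (B t) \<le> m" for t using B_norm[of t] k_pos by (simp add: m_def)
    show "2 * d * (norm y)\<^sup>2 \<le> 2 * (C t (B t y) \<bullet> y) + C' t y \<bullet> y" for t y
    proof -
      have "c * k * (norm y)\<^sup>2 \<ge> 0" using c_pos k_pos by simp
      then show ?thesis using B_form[of y t] by (simp add: d_def algebra_simps)
    qed
    show "2 * (d * (norm y)\<^sup>2 - c * norm y) \<le> 2 * (C t (f t y) \<bullet> y) + C' t y \<bullet> y" for t y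
    proof -
      let ?G = "g t (\<phi> t *\<^sub>R y) /\<^sub>R \<phi> t"
      have "c * norm ?G * norm y \<le> c * (k * norm y + 1) * norm y"
        using c_pos by (intro mult_right_mono mult_left_mono g_norm) auto
      then have "C t ?G \<bullet> y \<ge> - (c * (k * norm y + 1) * norm y)"
        using C_C[of t ?G y] by (simp add: abs_le_iff)
      moreover have "C t (f t y) \<bullet> y = C t (B t y) \<bullet> y + C t ?G \<bullet> y"
        by (simp add: f_def blinfun.bilinear_simps inner_add_left)
      ultimately show ?thesis
        using B_form[of y t] by (simp add: d_def algebra_simps power2_eq_square)
    qed
  qed (use f_cont B_cont C' C'_cont C_sym C_bij C_norm c_pos d_pos m_pos in auto)
  have root_iff: "is_root C c d m r \<longleftrightarrow> r \<ge> c / d \<and>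
      F_fun c d m r = F_fun c d m (c / d) + c\<^sup>2 / (2 * d\<^sup>2) * spread C" for r
    by (simp add: is_root_def spread_def)
  have "c\<^sup>2 / (2 * d\<^sup>2) * spread C \<ge> 0" using spread_bounds(1)[OF C_norm] by simp
  then have "\<exists>!r. is_root C c d m r"
    unfolding root_iff by (rule F_fun_root[OF m_pos c_pos d_pos])
  then obtain r where r: "is_root C c d m r" "\<And>r'. is_root C c d m r' \<Longrightarrow> r' = r" by blast
  have r': "c / d \<le> r" "F_main c d m r = F_main c d m (c / d) + c\<^sup>2 / (2 * d\<^sup>2) * spread C"
    using r(1) unfolding root_iff by (auto simp: F_fun_def)
  obtain y where y: "\<And>t. norm (y t) \<le> radius" "solves_on f UNIV y"
    using bounded_solution_exists by blast
  have yr: "norm (y t) \<le> r" for t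
    by (rule bounded_solution_estimate[OF y(2,1) spread_bounds(2)[OF C_norm] r'])
  define xs where "xs = (\<lambda>t. \<phi> t *\<^sub>R y t)"
  have xs: "solves_on (rhs A g) UNIV xs"
    unfolding solves_on_def
  proof
    fix t
    have y': "(y has_vector_derivative f t (y t)) (at t)" using y(2) by (simp add: solves_on_def)
    have "(\<phi> has_real_derivative \<phi>' t) (at t)"
      using \<phi>' by (simp add: has_real_derivative_iff_has_vector_derivative)
    from has_vector_derivative_scaleR[OF this y']
    show "(xs has_vector_derivative rhs A g t (xs t)) (at t)"
      using \<phi>_nz[of t]
      by (simp add: xs_def rhs_def f_def B_def \<psi>_def blinfun.bilinear_simps algebra_simps)
  qed
  have xs_r: "norm (xs t) \<le> r * \<phi> t" for t
    using yr[of t] \<phi>_pos[of t] by (simp add: xs_def mult.commute)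
  \<comment> \<open>For the difference of two solutions the Lipschitz condition gives
    \<open>norm (G t) \<le> k * norm (u t)\<close> with no additive constant, so the growth has no
    linear loss term and \<open>bounded_solution_zero\<close> applies.\<close>
  have "z = xs"
    if lip: "\<forall>t x y. norm (g t x - g t y) \<le> k * norm (x - y)"
      and z: "solves_on (rhs A g) UNIV z" "bdd_above (range (\<lambda>t. norm (z t) / \<phi> t))" for z
  proof
    fix t0
    obtain K where K: "\<And>t. norm (z t) / \<phi> t \<le> K" using z(2) by (auto simp: bdd_above_def)
    define u where "u = (\<lambda>t. (z t - xs t) /\<^sub>R \<phi> t)"
    define G where "G = (\<lambda>t. (g t (z t) - g t (xs t)) /\<^sub>R \<phi> t)"
    have u': "(u has_vector_derivative B t (u t) + G t) (at t)" for t
    proof -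
      have "((\<lambda>t. z t - xs t) has_vector_derivative rhs A g t (z t) - rhs A g t (xs t)) (at t)"
        using z(1) xs by (intro has_vector_derivative_diff) (auto simp: solves_on_def)
      from has_vector_derivative_quotient[OF this \<phi>' \<phi>_nz]
      show ?thesis
        by (simp add: u_def G_def B_def rhs_def \<psi>_def blinfun.bilinear_simps algebra_simps)
    qed
    have "u t0 = 0"
    proof (rule bounded_solution_zero[OF C' u' C_sym C_norm _ c_pos d_pos])
      fix t
      have "norm (u t) \<le> norm (z t) / \<phi> t + norm (xs t) / \<phi> t"
        using norm_triangle_ineq4[of "z t" "xs t"] \<phi>_pos[of t]
        by (simp add: u_def divide_inverse_commute[symmetric] add_divide_distrib[symmetric] divide_right_mono)
      also have "\<dots> \<le> K + r"
        using K[of t] xs_r[of t] \<phi>_pos[of t] by (intro add_mono) (auto simp: pos_divide_le_eq)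
      finally show "norm (u t) \<le> K + r" .
      have "norm (G t) \<le> k * norm (u t)"
        using lip \<phi>_pos[of t] by (simp add: G_def u_def divide_inverse_commute[symmetric] divide_right_mono)
      then have "c * norm (G t) * norm (u t) \<le> c * (k * norm (u t)) * norm (u t)"
        using c_pos by (intro mult_right_mono mult_left_mono) auto
      then have "C t (G t) \<bullet> u t \<ge> - (c * (k * norm (u t)) * norm (u t))"
        using C_C[of t "G t" "u t"] by (simp add: abs_le_iff)
      then show "2 * d * (norm (u t))\<^sup>2 \<le> 2 * (C t (B t (u t) + G t) \<bullet> u t) + C' t (u t) \<bullet> u t"
        using B_form[of "u t" t]
        by (simp add: d_def blinfun.bilinear_simps inner_add_left algebra_simps power2_eq_square)
    qed
    then show "z t0 = xs t0" using \<phi>_nz[of t0] by (simp add: u_def)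
  qed
  then show ?thesis
    using r xs xs_r by blast
qed

end
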